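(* Let $S\ge 2$ and $N\ge 2$ be integers and consider the single-user private information retrieval (PIR) problem with $S$ non-colluding databases, each storing the same $N$ files $W_1,\dots,W_N$, in which each file is divided into $S^{N-1}$ equal-size subfiles. For every demand $d\in[N]$, let $Q_1,\dots,Q_S$ be the query sets produced by the query-generation algorithm described in the context, run with independent uniformly random permutations $a^1,\dots,a^N$ of $[S^{N-1}]$. Then: (correctness) from the answers of all databases to the queries the user can recover all $S^{N-1}$ subfiles of $W_d$; (privacy) for each $j\in[S]$ the distribution of the query set sent to database $j$ does not depend on $d$, so no individual database obtains any information about the demand; (rate) the total number of downloaded bits divided by the file size $L$ equals $$R=1+\frac1S+\frac1{S^2}+\cdots+\frac1{S^{N-1}};$$ (optimality) this rate is optimal, i.e. the scheme achieves the capacity of PIR: no PIR scheme for $S$ non-colluding databases and $N$ files has a smaller rate (downloaded bits divided by file size).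
   Context: Notation: $[n]=\{1,\dots,n\}$. Each file $W_i$ has $L$ bits ($S^{N-1}\mid L$) and is divided into subfiles $W_i(1),\dots,W_i(S^{N-1})$ of equal size, viewed as bit vectors; sums are bitwise XOR. The user wants $W_d$ and knows $d$; the databases do not. A PIR scheme is a scheme in which the user sends queries to the databases, recovers $W_d$ exactly from their answers for every $d\in[N]$, and no individual database learns anything about $d$; its rate is the total number of downloaded bits divided by $L$ (so smaller is better). The permutations $a^i=(a^i_1,\dots,a^i_{S^{N-1}})$ are known only to the user. For $k\in[N]$ put $g(S,k)=\frac{S-1}{S}\left[(-1)^{k-1}+(S-1)^{k-2}\right]$, $f(S,k)=\frac1S\left[(-1)^k+(S-1)^{k-1}\right]$, and $\phi_1(S,k)=g(S,k)$, $\phi_i(S,k)=f(S,k)$ for $2\le i\le S$ (these are nonnegative integers). A query is a set of subfiles of distinct files; a query of size $k$ is called a $k$-sum. Its answer is the XOR of the subfiles in the set (so it has the size of one subfile). The collection $Q_j$ of queries is sent to database $j$ as an unordered collection of sums. Query-generation algorithm (input: $a^1,\dots,a^N$ and $d$). Initialize $Q_1=\{\{W_i(a^i_1)\}: i\in[N]\}$, $Q_j=\emptyset$ for $2\le j\le S$, $t_i=1$ for all $i\in[N]$, $k=2$. While $t_d<S^{N-1}$, do the following. For $j=1,\dots,S$ in order: (i) for every $i\in[S]\setminus\{j\}$ and every $Q\in Q_i$ with $|Q|=k-1$ containing no subfile of $W_d$, increase $t_d$ by one and add the query $Q\cup\{W_d(a^d_{t_d})\}$ to $Q_j$; (ii)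 if at least one query was added to $Q_j$ in (i), then for every $k$-subset $\{i_1,\dots,i_k\}\subseteq[N]\setminus\{d\}$, repeat $\phi_j(S,k)$ times: increase each of $t_{i_1},\dots,t_{i_k}$ by one and add the query $\{W_{i_1}(a^{i_1}_{t_{i_1}}),\dots,W_{i_k}(a^{i_k}_{t_{i_k}})\}$ to $Q_j$. After all $j$ have been processed, replace $k$ by $k+1$.
   Formalization: In the optimality claim, a PIR scheme's answers are functions of the query and the files, and the length of an answer may depend on the query but not on the contents of the files; otherwise answer lengths would carry uncounted information and the bound would fail. *)

theory Defs
  imports
    "HOL-Probability.Probability"
    "HOL-Combinatorics.Permutations"
    "HOL-Library.Z2"
    "HOL-Library.While_Combinator"
begin

section \<open>Private information retrieval schemes\<close>

text \<open>
  Files and databases are numbered from 1.  A file is a list of bits over the two-element field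
  \<^typ>\<open>bit\<close>, whose addition is XOR.
\<close>

definition file_systems :: "nat \<Rightarrow> nat \<Rightarrow> (nat \<Rightarrow> bit list) set" where
  "file_systems N L = {1..N} \<rightarrow>\<^sub>E {w. length w = L}"

text \<open>
  The user draws private randomness, independently of the files (which the user does not know),
  and computes from it and the demand one query for every database; a database answers as a
  function of the query it receives and of the files.  The argument order is demand, randomness,
  database for \<open>scheme_query\<close> and database, query, files for \<open>scheme_answer\<close>.
\<close>

record ('r, 'q) pir_scheme =
  scheme_rand :: "'r pmf"
  scheme_query :: "nat \<Rightarrow> 'r \<Rightarrow> nat \<Rightarrow> 'q"
  scheme_answer :: "nat \<Rightarrow> 'q \<Rightarrow> (nat \<Rightarrow> bit list) \<Rightarrow> bit list"

definition pir_correct :: "nat \<Rightarrow> nat \<Rightarrow> nat \<Rightarrow> ('r, 'q) pir_scheme \<Rightarrow> bool" where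
  "pir_correct S N L P \<longleftrightarrow>
     (\<forall>d\<in>{1..N}. \<forall>r\<in>set_pmf (scheme_rand P).
        \<exists>dec :: (nat \<Rightarrow> bit list) \<Rightarrow> bit list. \<forall>W\<in>file_systems N L.
          dec (\<lambda>j\<in>{1..S}. scheme_answer P j (scheme_query P d r j) W) = W d)"

definition pir_private :: "nat \<Rightarrow> nat \<Rightarrow> ('r, 'q) pir_scheme \<Rightarrow> bool" where
  "pir_private S N P \<longleftrightarrow>
     (\<forall>j\<in>{1..S}. \<forall>d\<in>{1..N}. \<forall>d'\<in>{1..N}.
        map_pmf (\<lambda>r. scheme_query P d r j) (scheme_rand P) =
        map_pmf (\<lambda>r. scheme_query P d' r j) (scheme_rand P))"

text \<open>
  The length of an answer may depend on the query but not on the contents of the files: a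
  length that varies with the files would itself carry information that is not accounted for
  when the downloaded bits are counted.
\<close>

definition pir_lengths_by_query :: "nat \<Rightarrow> nat \<Rightarrow> nat \<Rightarrow> ('r, 'q) pir_scheme \<Rightarrow> bool" where
  "pir_lengths_by_query S N L P \<longleftrightarrow>
     (\<forall>d\<in>{1..N}. \<forall>r\<in>set_pmf (scheme_rand P). \<forall>j\<in>{1..S}.
        \<forall>W\<in>file_systems N L. \<forall>W'\<in>file_systems N L.
          length (scheme_answer P j (scheme_query P d r j) W) =
          length (scheme_answer P j (scheme_query P d r j) W'))"

definition is_pir_scheme :: "nat \<Rightarrow> nat \<Rightarrow> nat \<Rightarrow> ('r, 'q) pir_scheme \<Rightarrow> bool" where
  "is_pir_scheme S N L P \<longleftrightarrow>
     pir_correct S N L P \<and> pir_private S N P \<and> pir_lengths_by_query S N L P"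

text \<open>
  The rate is the expected number of downloaded bits divided by the file size.  It is an extended
  nonnegative real, so that an infinite expectation is not mistaken for 0.
\<close>

definition pir_rate :: "nat \<Rightarrow> nat \<Rightarrow> ('r, 'q) pir_scheme \<Rightarrow> nat \<Rightarrow> (nat \<Rightarrow> bit list) \<Rightarrow> ennreal" where
  "pir_rate S L P d W =
     (\<integral>\<^sup>+ r. of_nat (\<Sum>j=1..S. length (scheme_answer P j (scheme_query P d r j) W))
        \<partial>measure_pmf (scheme_rand P)) / of_nat L"


section \<open>The query-generation algorithm\<close>

definition g_sum :: "nat \<Rightarrow> nat \<Rightarrow> real" where
  "g_sum S k = (real S - 1) / real S * ((-1) powi (int k - 1) + (real S - 1) powi (int k - 2))"

definition f_sum :: "nat \<Rightarrow> nat \<Rightarrow> real" where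
  "f_sum S k = 1 / real S * ((-1) ^ k + (real S - 1) powi (int k - 1))"

text \<open>
  For \<open>S \<ge> 2\<close> and \<open>k \<ge> 1\<close> the values of \<^const>\<open>f_sum\<close> and \<^const>\<open>g_sum\<close> are
  nonnegative integers, so no rounding takes place here.
\<close>

definition phi :: "nat \<Rightarrow> nat \<Rightarrow> nat \<Rightarrow> nat" where
  "phi i S k = nat \<lfloor>if i = 1 then g_sum S k else f_sum S k\<rfloor>"

text \<open>
  The pair \<open>(i, m)\<close> stands for the subfile \<open>W\<^sub>i(m)\<close>, and a query for the set of its subfiles.
\<close>

type_synonym sum_query = "(nat \<times> nat) set"

text \<open>
  The collections \<open>Q\<^sub>j\<close> are kept as lists in the order of generation.  This only serves to fix the
  order in which the loops of the algorithm run through them; a database receives the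
  underlying set.
\<close>

record query_state =
  collection :: "nat \<Rightarrow> sum_query list"
  counter :: "nat \<Rightarrow> nat"

definition initial_state :: "nat \<Rightarrow> (nat \<Rightarrow> nat \<Rightarrow> nat) \<Rightarrow> query_state" where
  "initial_state N a =
     \<lparr>collection = (\<lambda>_. [])(1 := map (\<lambda>i. {(i, a i 1)}) [1..<Suc N]), counter = (\<lambda>_. 1)\<rparr>"

definition side_information :: "nat \<Rightarrow> nat \<Rightarrow> nat \<Rightarrow> nat \<Rightarrow> query_state \<Rightarrow> sum_query list" where
  "side_information S d k j st =
     [Q. i \<leftarrow> [1..<Suc S], i \<noteq> j, Q \<leftarrow> collection st i, card Q = k - 1 \<and> d \<notin> fst ` Q]"

definition add_demand_sum ::
  "(nat \<Rightarrow> nat \<Rightarrow> nat) \<Rightarrow> nat \<Rightarrow> nat \<Rightarrow> sum_query \<Rightarrow> query_state \<Rightarrow> query_state" where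
  "add_demand_sum a d j Q st =
     (let t = (counter st)(d := counter st d + 1) in
      \<lparr>collection = (collection st)(j := collection st j @ [Q \<union> {(d, a d (t d))}]),
       counter = t\<rparr>)"

definition add_fresh_sum ::
  "(nat \<Rightarrow> nat \<Rightarrow> nat) \<Rightarrow> nat \<Rightarrow> nat set \<Rightarrow> query_state \<Rightarrow> query_state" where
  "add_fresh_sum a j K st =
     (let t = (\<lambda>i. if i \<in> K then counter st i + 1 else counter st i) in
      \<lparr>collection = (collection st)(j := collection st j @ [(\<lambda>i. (i, a i (t i))) ` K]),
       counter = t\<rparr>)"

definition other_file_subsets :: "nat \<Rightarrow> nat \<Rightarrow> nat \<Rightarrow> nat set list" where
  "other_file_subsets N d k =
     map set (filter (\<lambda>is. length is = k) (List.subseqs (filter (\<lambda>i. i \<noteq> d) [1..<Suc N])))"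

definition process_database ::
  "nat \<Rightarrow> nat \<Rightarrow> (nat \<Rightarrow> nat \<Rightarrow> nat) \<Rightarrow> nat \<Rightarrow> nat \<Rightarrow> nat \<Rightarrow> query_state \<Rightarrow> query_state" where
  "process_database S N a d k j st =
     (let side = side_information S d k j st;
          st' = fold (add_demand_sum a d j) side st
      in if side = [] then st'
         else fold (\<lambda>K. add_fresh_sum a j K ^^ phi j S k) (other_file_subsets N d k) st')"

definition process_round ::
  "nat \<Rightarrow> nat \<Rightarrow> (nat \<Rightarrow> nat \<Rightarrow> nat) \<Rightarrow> nat \<Rightarrow> nat \<Rightarrow> query_state \<Rightarrow> query_state" where
  "process_round S N a d k st = fold (process_database S N a d k) [1..<Suc S] st"

definition generate_queries ::
  "nat \<Rightarrow> nat \<Rightarrow> nat \<Rightarrow> (nat \<Rightarrow> nat \<Rightarrow> nat) \<Rightarrow> query_state" where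
  "generate_queries S N d a =
     fst (while (\<lambda>(st, k). counter st d < S ^ (N - 1))
                (\<lambda>(st, k). (process_round S N a d k st, k + 1))
                (initial_state N a, 2))"

definition query_set :: "nat \<Rightarrow> nat \<Rightarrow> nat \<Rightarrow> (nat \<Rightarrow> nat \<Rightarrow> nat) \<Rightarrow> nat \<Rightarrow> sum_query set" where
  "query_set S N d a j = set (collection (generate_queries S N d a) j)"

definition random_permutations :: "nat \<Rightarrow> nat \<Rightarrow> (nat \<Rightarrow> nat \<Rightarrow> nat) pmf" where
  "random_permutations S N =
     Pi_pmf {1..N} id (\<lambda>_. pmf_of_set {p. p permutes {1..S ^ (N - 1)}})"


section \<open>Answers\<close>

text \<open>Here \<open>b\<close> is the length of a subfile.\<close>

definition subfile :: "nat \<Rightarrow> (nat \<Rightarrow> bit list) \<Rightarrow> nat \<Rightarrow> nat \<Rightarrow> bit list" where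
  "subfile b W i m = take b (drop ((m - 1) * b) (W i))"

definition sum_answer :: "nat \<Rightarrow> (nat \<Rightarrow> bit list) \<Rightarrow> sum_query \<Rightarrow> bit list" where
  "sum_answer b W Q = map (\<lambda>p. \<Sum>(i, m)\<in>Q. subfile b W i m ! p) [0..<b]"

text \<open>
  The algorithm as a PIR scheme: a database concatenates its answers to the individual sums in
  an order that depends only on the set of sums it has received.
\<close>

definition set_listing :: "'a set \<Rightarrow> 'a list" where
  "set_listing A = (SOME xs. set xs = A \<and> distinct xs)"

definition algorithm_scheme ::
  "nat \<Rightarrow> nat \<Rightarrow> nat \<Rightarrow> (nat \<Rightarrow> nat \<Rightarrow> nat, sum_query set) pir_scheme" where
  "algorithm_scheme S N L =
     \<lparr>scheme_rand = random_permutations S N,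
      scheme_query = query_set S N,
      scheme_answer = (\<lambda>j Qs W. concat (map (sum_answer (L div S ^ (N - 1)) W) (set_listing Qs)))\<rparr>"

end

theory Submission
  imports Defs
begin

text \<open>
  Achievability.  The recurrences \<open>g(S, k+1) = (S-1) f(S, k)\<close> and
  \<open>f(S, k+1) = g(S, k) + (S-2) f(S, k)\<close> say that every database obtains the same number
  \<open>\<phi>\<^sub>j(S, |K|)\<close> of sums of each type \<open>K\<close>, whether or not \<open>K\<close> contains the demand.  As the
  queries to one database are pairwise disjoint, a renaming of the subfiles turns the queries for
  one demand into those for another, and uniform permutations absorb the renaming.  Over all
  databases there are \<open>(S-1)\<^bsup>|K|-1\<^esup>\<close> sums of type \<open>K\<close>, so the numbers of subfiles and of sums are
  binomial sums.

  Converse.  Shannon entropy can be replaced by the average of the logarithm of the number of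
  possible answers.  This quantity is monotone and subadditive, and concavity of the logarithm
  gives the one chain rule that is needed: once the answers determine a file, revealing that file
  costs at least \<open>L\<close> bits.  Passing from all answers to a single one loses a factor \<open>S\<close>, and
  privacy allows the demand to be changed at that moment, which yields the geometric sum.
\<close>

section \<open>Converse\<close>

text \<open>The numbers \<open>phi j S k\<close> are forced. Demand sums of size
  \<open>k + 1\<close> in database \<open>j\<close> use each demand-free \<open>k\<close>-sum of the
  other databases once, so passing from \<open>k\<close> to \<open>k + 1\<close> multiplies the
  vector of multiplicities by \<open>J - I\<close>, where \<open>J\<close> is the all-ones matrix of
  order \<open>S\<close>. It starts as the first unit vector, since only database 1 receives single
  subfiles. The eigenvalues \<open>S - 1\<close> and \<open>-1\<close> of this matrix are the bases
  of the powers in \<open>g_sum\<close> and \<open>f_sum\<close>.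

  All databases share the counters, which also control the loop, but no test depends on the value of
  an index. Hence the run is analysed once, with identity indices, and the permutations enter
  afterwards as a renaming. Privacy then compares two deterministic runs, and the renaming between
  them may be chosen separately for each database.

  In the converse the randomness is held fixed while the files vary. Averaging the logarithm over
  all file systems, instead of taking a maximum, lets the mean over the contents of a revealed file
  be absorbed into the next conditional quantity.\<close>

lemma UNIV_bit_eq: "(UNIV :: bit set) = {0, 1}"
proof (rule set_eqI)
  show "b \<in> UNIV \<longleftrightarrow> b \<in> {0, 1}" for b :: bit by (cases b) auto
qed

lemma finite_bit_lists: "finite {w :: bit list. length w = n}"
  and card_bit_lists: "card {w :: bit list. length w = n} = 2 ^ n"
proof -
  have fin: "finite (UNIV :: bit set)" and card: "card (UNIV :: bit set) = 2"
    by (simp_all add: UNIV_bit_eq)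
  have eq: "{w :: bit list. length w = n} = {w. set w \<subseteq> UNIV \<and> length w = n}" by simp
  show "finite {w :: bit list. length w = n}"
    unfolding eq by (rule finite_lists_length_eq[OF fin])
  show "card {w :: bit list. length w = n} = 2 ^ n"
    unfolding eq card_lists_length_eq[OF fin] card ..
qed

lemma finite_file_systems: "finite (file_systems N L)"
  unfolding file_systems_def by (intro finite_PiE finite_bit_lists) simp

lemma file_systems_nonempty: "file_systems N L \<noteq> {}"
proof -
  have "replicate L 0 \<in> {w :: bit list. length w = L}" by simp
  then show ?thesis unfolding file_systems_def PiE_eq_empty_iff by blast
qed

section \<open>Conditional Hartley entropy of the answers\<close>

definition agreeing :: "nat \<Rightarrow> nat \<Rightarrow> nat set \<Rightarrow> (nat \<Rightarrow> bit list) \<Rightarrow> (nat \<Rightarrow> bit list) set" where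
  "agreeing N L T W = {W'\<in>file_systems N L. \<forall>i\<in>T. W' i = W i}"

text \<open>
  The conditional Hartley entropy of \<open>F\<close> given the files in \<open>T\<close>, summed instead of averaged over
  the file systems.
\<close>

definition hartley :: "nat \<Rightarrow> nat \<Rightarrow> ((nat \<Rightarrow> bit list) \<Rightarrow> 'x) \<Rightarrow> nat set \<Rightarrow> real" where
  "hartley N L F T = (\<Sum>W\<in>file_systems N L. log 2 (card (F ` agreeing N L T W)))"

lemma finite_agreeing: "finite (agreeing N L T W)"
  unfolding agreeing_def using finite_file_systems by auto

lemma agreeing_subset: "agreeing N L T W \<subseteq> file_systems N L"
  by (auto simp: agreeing_def)

lemma self_agreeing: "W \<in> file_systems N L \<Longrightarrow> W \<in> agreeing N L T W"
  by (auto simp: agreeing_def)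

lemma card_image_agreeing_pos:
  assumes "W \<in> file_systems N L"
  shows "card (F ` agreeing N L T W) > 0"
  using finite_agreeing[of N L T W] self_agreeing[OF assms, of T] by (auto simp: card_gt_0_iff)

lemma hartley_nonneg: "hartley N L F T \<ge> 0"
  unfolding hartley_def
proof (rule sum_nonneg)
  fix W assume "W \<in> file_systems N L"
  from card_image_agreeing_pos[OF this, of F T]
  show "0 \<le> log 2 (card (F ` agreeing N L T W))" by (simp add: zero_le_log_cancel_iff)
qed

lemma log_card_mono:
  assumes "card A > 0" "card A \<le> card B"
  shows "log 2 (card A) \<le> log 2 (card B)"
  using assms by simp

text \<open>A bound independent of \<open>F\<close>. It makes \<open>hartley\<close> integrable over
  any randomness, however large the set of queries is.\<close>

lemma hartley_le:
  "hartley N L F T \<le> card (file_systems N L) * log 2 (card (file_systems N L))"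
proof -
  have "hartley N L F T \<le> (\<Sum>W\<in>file_systems N L. log 2 (card (file_systems N L)))"
    unfolding hartley_def
  proof (rule sum_mono, rule log_card_mono)
    fix W assume "W \<in> file_systems N L"
    then show "0 < card (F ` agreeing N L T W)" by (rule card_image_agreeing_pos)
    have "card (F ` agreeing N L T W) \<le> card (agreeing N L T W)"
      by (rule card_image_le[OF finite_agreeing])
    also have "\<dots> \<le> card (file_systems N L)"
      by (rule card_mono[OF finite_file_systems agreeing_subset])
    finally show "card (F ` agreeing N L T W) \<le> card (file_systems N L)" .
  qed
  then show ?thesis by simp
qed

text \<open>Monotonicity: projection to coordinate \<open>j\<close> maps the possible tuples onto
  the possible values of \<open>A j\<close>.\<close>

lemma hartley_component_le:
  assumes "j \<in> J"
  shows "hartley N L (A j) T \<le> hartley N L (\<lambda>W. \<lambda>j\<in>J. A j W) T"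
  unfolding hartley_def
proof (rule sum_mono, rule log_card_mono)
  fix W assume W: "W \<in> file_systems N L"
  let ?X = "agreeing N L T W"
  show "0 < card (A j ` ?X)" using W by (rule card_image_agreeing_pos)
  have "A j ` ?X = (\<lambda>f. f j) ` (\<lambda>W. \<lambda>j\<in>J. A j W) ` ?X"
    using assms by (simp add: image_image)
  then show "card (A j ` ?X) \<le> card ((\<lambda>W. \<lambda>j\<in>J. A j W) ` ?X)"
    by (simp add: card_image_le finite_agreeing)
qed

text \<open>Subadditivity: the possible tuples lie in the product of the coordinate ranges, whose
  cardinalities multiply.\<close>

lemma hartley_tuple_le:
  assumes "finite J"
  shows "hartley N L (\<lambda>W. \<lambda>j\<in>J. A j W) T \<le> (\<Sum>j\<in>J. hartley N L (A j) T)"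
proof -
  have "log 2 (card ((\<lambda>W. \<lambda>j\<in>J. A j W) ` agreeing N L T W))
      \<le> (\<Sum>j\<in>J. log 2 (card (A j ` agreeing N L T W)))" if W: "W \<in> file_systems N L" for W
  proof -
    let ?X = "agreeing N L T W"
    have "(\<lambda>W. \<lambda>j\<in>J. A j W) ` ?X \<subseteq> (\<Pi>\<^sub>E j\<in>J. A j ` ?X)" by auto
    then have "card ((\<lambda>W. \<lambda>j\<in>J. A j W) ` ?X) \<le> card (\<Pi>\<^sub>E j\<in>J. A j ` ?X)"
      by (intro card_mono finite_PiE assms finite_imageI finite_agreeing)
    then have "log 2 (card ((\<lambda>W. \<lambda>j\<in>J. A j W) ` ?X)) \<le> log 2 (card (\<Pi>\<^sub>E j\<in>J. A j ` ?X))"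
      using card_image_agreeing_pos[OF W] by (intro log_card_mono)
    also have "\<dots> = log 2 (\<Prod>j\<in>J. real (card (A j ` ?X)))"
      using assms by (simp add: card_PiE)
    also have "\<dots> = (\<Sum>j\<in>J. log 2 (card (A j ` ?X)))"
    proof -
      have "real (card (A j ` ?X)) \<noteq> 0" for j
        using card_image_agreeing_pos[OF W, of "A j" T] by simp
      with assms show ?thesis by (simp add: log_def ln_prod sum_divide_distrib)
    qed
    finally show ?thesis .
  qed
  then have "hartley N L (\<lambda>W. \<lambda>j\<in>J. A j W) T
      \<le> (\<Sum>W\<in>file_systems N L. \<Sum>j\<in>J. log 2 (card (A j ` agreeing N L T W)))"
    unfolding hartley_def by (rule sum_mono)
  also have "\<dots> = (\<Sum>j\<in>J. hartley N L (A j) T)"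
    unfolding hartley_def by (rule sum.swap)
  finally show ?thesis .
qed

text \<open>Jensen's inequality with uniform weights, the logarithm of the mean being split into
  that of the sum minus \<open>log 2 (card A)\<close>. When \<open>A\<close> is the set of contents
  of one file, this last term is \<open>L\<close>.\<close>

lemma log_sum_ge_average_log:
  fixes c :: "'a \<Rightarrow> real"
  assumes "finite A" "A \<noteq> {}" "\<And>x. x \<in> A \<Longrightarrow> c x > 0"
  shows "log 2 (card A) + (\<Sum>x\<in>A. log 2 (c x)) / card A \<le> log 2 (\<Sum>x\<in>A. c x)"
proof -
  have pos: "card A > 0" using assms by (simp add: card_gt_0_iff)
  have "concave_on {0<..} (log 2)" by (rule log_concave) simp
  from concave_on_sum[OF assms(1,2) this, of "\<lambda>_. 1 / card A" c]
  have "(\<Sum>x\<in>A. log 2 (c x)) / card A \<le> log 2 ((\<Sum>x\<in>A. c x) / card A)"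
    using assms pos by (simp add: sum_divide_distrib)
  also have "\<dots> = log 2 (\<Sum>x\<in>A. c x) - log 2 (card A)"
    using assms pos sum_pos[of A c] by (subst log_divide) auto
  finally show ?thesis by simp
qed

lemma sum_file_systems_update:
  assumes "d \<in> {1..N}"
  shows "(\<Sum>W\<in>file_systems N L. \<Sum>v | length v = L. G (W(d := v)))
       = 2 ^ L * (\<Sum>W\<in>file_systems N L. G W :: real)"
proof -
  let ?V = "{v :: bit list. length v = L}"
  \<comment> \<open>Exchanging file \<open>d\<close> with \<open>v\<close> is an involution on these
    pairs; it trades the altered file system for the original one.\<close>
  let ?f = "\<lambda>(W, v). (W(d := v), W d)"
  have "(\<Sum>W\<in>file_systems N L. \<Sum>v\<in>?V. G (W(d := v)))
      = (\<Sum>p\<in>file_systems N L \<times> ?V. (\<lambda>(W, v). G W) (?f p))"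
    by (simp add: sum.cartesian_product case_prod_unfold)
  also have "\<dots> = (\<Sum>p\<in>file_systems N L \<times> ?V. (\<lambda>(W, v). G W) p)"
    using assms
    by (intro sum.reindex_bij_witness[of _ ?f ?f])
       (auto simp: file_systems_def PiE_iff extensional_def fun_upd_idem_iff)
  also have "\<dots> = 2 ^ L * (\<Sum>W\<in>file_systems N L. G W)"
    by (simp add: sum.cartesian_product[symmetric] card_bit_lists sum_distrib_left)
  finally show ?thesis .
qed

text \<open>
  The chain rule.  Since the answers determine \<open>W\<^sub>d\<close>, the sets of answers belonging to different
  contents \<open>v\<close> of file \<open>d\<close> are disjoint, and concavity of the logarithm applies to the sum of
  their cardinalities.
\<close>

lemma hartley_demand:
  assumes d: "d \<in> {1..N}" "d \<notin> T"
    and dec: "\<And>W. W \<in> file_systems N L \<Longrightarrow> dec (F W) = W d"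
  shows "card (file_systems N L) * real L + hartley N L F (insert d T) \<le> hartley N L F T"
proof -
  let ?V = "{v :: bit list. length v = L}"
  let ?c = "\<lambda>W. real (card (F ` agreeing N L (insert d T) W))"
  have upd: "W(d := v) \<in> file_systems N L" if "W \<in> file_systems N L" "v \<in> ?V" for W v
    using that d by (auto simp: file_systems_def PiE_iff extensional_def)
  have "real L + (\<Sum>v\<in>?V. log 2 (?c (W(d := v)))) / 2 ^ L
      \<le> log 2 (card (F ` agreeing N L T W))" if W: "W \<in> file_systems N L" for W
  proof -
    have "agreeing N L T W = (\<Union>v\<in>?V. agreeing N L (insert d T) (W(d := v)))"
      using d W by (auto simp: agreeing_def file_systems_def PiE_iff)
    then have eq: "F ` agreeing N L T W
        = (\<Union>v\<in>?V. F ` agreeing N L (insert d T) (W(d := v)))"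
      by (simp add: image_UN)
    have decv: "dec y = v" if "y \<in> F ` agreeing N L (insert d T) (W(d := v))" for y v
      using that dec by (auto simp: agreeing_def)
    have "card (F ` agreeing N L T W)
        = (\<Sum>v\<in>?V. card (F ` agreeing N L (insert d T) (W(d := v))))"
      unfolding eq using decv
      by (intro card_UN_disjoint finite_bit_lists ballI finite_imageI finite_agreeing impI) blast
    then have sum: "real (card (F ` agreeing N L T W)) = (\<Sum>v\<in>?V. ?c (W(d := v)))"
      by simp
    have "log 2 (card ?V) + (\<Sum>v\<in>?V. log 2 (?c (W(d := v)))) / card ?V
        \<le> log 2 (\<Sum>v\<in>?V. ?c (W(d := v)))"
    proof (rule log_sum_ge_average_log[OF finite_bit_lists])
      show "?V \<noteq> {}" by (auto intro: exI[of _ "replicate L 0"])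
      show "0 < ?c (W(d := v))" if "v \<in> ?V" for v
        using card_image_agreeing_pos[OF upd[OF W that]] by simp
    qed
    then show ?thesis by (simp add: sum card_bit_lists)
  qed
  then have "(\<Sum>W\<in>file_systems N L. real L + (\<Sum>v\<in>?V. log 2 (?c (W(d := v)))) / 2 ^ L)
      \<le> hartley N L F T"
    unfolding hartley_def by (rule sum_mono)
  \<comment> \<open>Replacing file \<open>d\<close> by a uniform \<open>v\<close> preserves the
    uniform distribution on file systems, so the inner mean disappears.\<close>
  moreover have "(\<Sum>W\<in>file_systems N L. real L + (\<Sum>v\<in>?V. log 2 (?c (W(d := v)))) / 2 ^ L)
      = card (file_systems N L) * real L + hartley N L F (insert d T)"
    using sum_file_systems_update[OF d(1), where G = "\<lambda>W. log 2 (?c W)"]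
    by (simp add: sum.distrib sum_divide_distrib[symmetric] hartley_def)
  ultimately show ?thesis by simp
qed

text \<open>With one length for all files only \<open>2 ^ l\<close> answers are possible. Lengths
  that vary with the files would allow more.\<close>

lemma hartley_le_length:
  assumes "\<And>W. W \<in> file_systems N L \<Longrightarrow> length (F W :: bit list) = l"
  shows "hartley N L F T \<le> card (file_systems N L) * real l"
proof -
  have "log 2 (card (F ` agreeing N L T W)) \<le> l" if W: "W \<in> file_systems N L" for W
  proof -
    have "F ` agreeing N L T W \<subseteq> {v. length v = l}"
      using assms by (auto simp: agreeing_def)
    then have "card (F ` agreeing N L T W) \<le> 2 ^ l"
      by (metis card_bit_lists card_mono finite_bit_lists)
    then have "real (card (F ` agreeing N L T W)) \<le> 2 ^ l"
      by (metis of_nat_le_iff of_nat_numeral of_nat_power)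
    with card_image_agreeing_pos[OF W, of F T] show ?thesis
      by (simp add: log_le_iff powr_realpow)
  qed
  then have "hartley N L F T \<le> (\<Sum>W\<in>file_systems N L. real l)"
    unfolding hartley_def by (rule sum_mono)
  then show ?thesis by simp
qed

section \<open>Induction over the demands\<close>

definition answers :: "nat \<Rightarrow> ('r, 'q) pir_scheme \<Rightarrow> nat \<Rightarrow> 'r \<Rightarrow> (nat \<Rightarrow> bit list) \<Rightarrow> nat \<Rightarrow> bit list" where
  "answers S P d r W = (\<lambda>j\<in>{1..S}. scheme_answer P j (scheme_query P d r j) W)"

lemma integrable_hartley:
  "integrable (measure_pmf p) (\<lambda>r. hartley N L (F r) T)"
proof (rule measure_pmf.integrable_const_bound)
  show "AE r in measure_pmf p. norm (hartley N L (F r) T)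
      \<le> card (file_systems N L) * log 2 (card (file_systems N L))"
    using hartley_le[of N L _ T] by (intro AE_I2) (simp add: hartley_nonneg)
qed simp

text \<open>
  Each round of the induction reveals the demanded file and passes to a new demand: the answers
  dominate each single answer, whose query distribution is the same for the new demand.
\<close>

lemma expected_hartley_ge:
  assumes P: "pir_correct S N L P" "pir_private S N P" and S: "S > 0"
    and "d \<in> {1..N}" "T \<subseteq> {1..N}" "d \<notin> T"
  shows "card (file_systems N L) * real L * (\<Sum>i<N - card T. 1 / real S ^ i)
       \<le> (LINT r|measure_pmf (scheme_rand P). hartley N L (answers S P d r) T)"
  using assms(4-)
proof (induction "N - card T" arbitrary: d T)
  case 0
  then show ?case by (simp add: integral_nonneg_AE hartley_nonneg)
next
  case (Suc n)
  let ?p = "scheme_rand P"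
  let ?M = "measure_pmf ?p"
  let ?C = "card (file_systems N L) * real L"
  let ?T = "insert d T"
  have finT: "finite T" using Suc.prems(2) finite_subset by blast
  have cardT: "card ?T = card T + 1" using Suc.prems finT by simp
  have rec: "?C * (\<Sum>i<n. 1 / real S ^ i)
      \<le> real S * (LINT r|?M. hartley N L (answers S P d r) ?T)"
  \<comment> \<open>For \<open>n = 0\<close> every file has been revealed and the sum is empty;
    otherwise some demand outside \<open>?T\<close> is left.\<close>
  proof (cases n)
    case 0
    then show ?thesis by (simp add: integral_nonneg_AE hartley_nonneg)
  next
    case (Suc n')
    have "card ?T < card {1..N}" using Suc \<open>Suc n = N - card T\<close> cardT by simp
    then obtain d' where d': "d' \<in> {1..N}" "d' \<notin> ?T"
      using Suc.prems by (metis finT card_mono finite_insert leD subsetI)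
    have "?C * (\<Sum>i<N - card ?T. 1 / real S ^ i)
        \<le> (LINT r|?M. hartley N L (answers S P d' r) ?T)"
      using Suc.prems Suc.hyps d' cardT by (intro Suc.hyps) auto
    also have "\<dots> \<le> (LINT r|?M. (\<Sum>j=1..S.
        hartley N L (scheme_answer P j (scheme_query P d' r j)) ?T))"
      unfolding answers_def
      by (intro integral_mono integrable_hartley Bochner_Integration.integrable_sum
          hartley_tuple_le) auto
    also have "\<dots> = (\<Sum>j=1..S. LINT r|?M.
        hartley N L (scheme_answer P j (scheme_query P d' r j)) ?T)"
      by (intro Bochner_Integration.integral_sum integrable_hartley)
    also have "\<dots> = (\<Sum>j=1..S. LINT r|?M.
        hartley N L (scheme_answer P j (scheme_query P d r j)) ?T)"
    \<comment> \<open>With \<open>?T\<close> fixed, the integrand depends on \<open>r\<close> only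
      through the query to database \<open>j\<close>, so equality of the two query distributions
      suffices.\<close>
    proof (rule sum.cong[OF refl])
      fix j assume "j \<in> {1..S}"
      then have "map_pmf (\<lambda>r. scheme_query P d' r j) ?p = map_pmf (\<lambda>r. scheme_query P d r j) ?p"
        using P(2) d'(1) Suc.prems(1) unfolding pir_private_def by blast
      then have "(LINT q|map_pmf (\<lambda>r. scheme_query P d' r j) ?p.
            hartley N L (scheme_answer P j q) ?T)
          = (LINT q|map_pmf (\<lambda>r. scheme_query P d r j) ?p. hartley N L (scheme_answer P j q) ?T)"
        by simp
      then show "(LINT r|?M. hartley N L (scheme_answer P j (scheme_query P d' r j)) ?T)
          = (LINT r|?M. hartley N L (scheme_answer P j (scheme_query P d r j)) ?T)"
        by simp
    qed
    \<comment> \<open>Each of the \<open>S\<close> single answers is dominated by all answers for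
      the old demand; this is the factor \<open>S\<close> lost per revealed file.\<close>
    also have "\<dots> \<le> (\<Sum>j=1..S. LINT r|?M. hartley N L (answers S P d r) ?T)"
      unfolding answers_def
      by (intro sum_mono integral_mono integrable_hartley hartley_component_le)
    finally show ?thesis
    proof -
      have "N - card ?T = n" using Suc.hyps(2) cardT by simp
      moreover assume "?C * (\<Sum>i<N - card ?T. 1 / real S ^ i)
          \<le> (\<Sum>j=1..S. LINT r|?M. hartley N L (answers S P d r) ?T)"
      ultimately show ?thesis by simp
    qed
  qed
  have "?C + (LINT r|?M. hartley N L (answers S P d r) ?T)
      = (LINT r|?M. ?C + hartley N L (answers S P d r) ?T)"
    by (subst Bochner_Integration.integral_add) (auto intro: integrable_hartley)
  also have "\<dots> \<le> (LINT r|?M. hartley N L (answers S P d r) T)"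
  proof (rule integral_mono_AE)
    show "AE r in ?M. ?C + hartley N L (answers S P d r) ?T \<le> hartley N L (answers S P d r) T"
    proof (rule AE_pmfI)
      fix r assume "r \<in> set_pmf ?p"
      then obtain dec where "\<forall>W\<in>file_systems N L. dec (answers S P d r W) = W d"
        using P(1) Suc.prems(1) unfolding pir_correct_def answers_def by blast
      then show "?C + hartley N L (answers S P d r) ?T \<le> hartley N L (answers S P d r) T"
        using Suc.prems by (intro hartley_demand) auto
    qed
  qed (auto intro: integrable_hartley)
  finally have "?C + (LINT r|?M. hartley N L (answers S P d r) ?T)
      \<le> (LINT r|?M. hartley N L (answers S P d r) T)" .
  moreover have "?C * (\<Sum>i<n. 1 / real S ^ i) / real S
      \<le> (LINT r|?M. hartley N L (answers S P d r) ?T)"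
    using rec S by (simp add: field_simps)
  moreover have "(\<Sum>i<Suc n. 1 / real S ^ i) = 1 + (\<Sum>i<n. 1 / real S ^ i) / real S"
    unfolding sum.lessThan_Suc_shift by (simp add: sum_divide_distrib mult.commute)
  ultimately show ?case
    unfolding \<open>Suc n = N - card T\<close>[symmetric] by (simp add: algebra_simps)
qed

text \<open>Answer lengths are tied to the query, so the download for the given \<open>W\<close>
  bounds the Hartley entropy averaged over all file systems.\<close>

theorem pir_rate_ge_capacity:
  fixes P :: "('r, 'q) pir_scheme"
  assumes P: "is_pir_scheme S N L P" and S: "S > 0" and L: "L > 0"
    and d: "d \<in> {1..N}" and W: "W \<in> file_systems N L"
  shows "pir_rate S L P d W \<ge> ennreal (\<Sum>i<N. 1 / real S ^ i)"
proof -
  let ?p = "scheme_rand P"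
  let ?\<Omega> = "card (file_systems N L)"
  let ?len = "\<lambda>r. \<Sum>j=1..S. length (scheme_answer P j (scheme_query P d r j) W)"
  have \<Omega>: "?\<Omega> > 0" using finite_file_systems file_systems_nonempty by (simp add: card_gt_0_iff)
  have le: "hartley N L (answers S P d r) {} / ?\<Omega> \<le> ?len r" if r: "r \<in> set_pmf ?p" for r
  proof -
    have "hartley N L (answers S P d r) {}
        \<le> (\<Sum>j=1..S. hartley N L (scheme_answer P j (scheme_query P d r j)) {})"
      unfolding answers_def by (rule hartley_tuple_le) simp
    also have "\<dots> \<le> (\<Sum>j=1..S. ?\<Omega> * real (length (scheme_answer P j (scheme_query P d r j) W)))"
      using P d r W unfolding is_pir_scheme_def pir_lengths_by_query_def
      by (intro sum_mono hartley_le_length) blast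
    finally show ?thesis using \<Omega> by (simp add: sum_distrib_left[symmetric] field_simps)
  qed
  have "?\<Omega> * real L * (\<Sum>i<N - card ({} :: nat set). 1 / real S ^ i)
      \<le> (LINT r|measure_pmf ?p. hartley N L (answers S P d r) {})"
    using P S d unfolding is_pir_scheme_def by (intro expected_hartley_ge) auto
  then have "real L * (\<Sum>i<N. 1 / real S ^ i)
      \<le> (LINT r|measure_pmf ?p. hartley N L (answers S P d r) {} / ?\<Omega>)"
    using \<Omega> by (simp add: field_simps)
  then have "ennreal (real L * (\<Sum>i<N. 1 / real S ^ i))
      \<le> ennreal (LINT r|measure_pmf ?p. hartley N L (answers S P d r) {} / ?\<Omega>)"
    by (rule ennreal_leI)
  \<comment> \<open>The entropy is bounded, so its two integrals agree. The expected download may be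
    infinite and stays a nonnegative integral.\<close>
  also have "\<dots> = (\<integral>\<^sup>+ r. ennreal (hartley N L (answers S P d r) {} / ?\<Omega>) \<partial>measure_pmf ?p)"
    by (intro nn_integral_eq_integral[symmetric] integrable_divide_zero integrable_hartley AE_I2)
       (simp_all add: hartley_nonneg)
  also have "\<dots> \<le> (\<integral>\<^sup>+ r. of_nat (?len r) \<partial>measure_pmf ?p)"
  proof (rule nn_integral_mono_AE, rule AE_pmfI)
    fix r assume "r \<in> set_pmf ?p"
    from ennreal_leI[OF le[OF this]]
    show "ennreal (hartley N L (answers S P d r) {} / ?\<Omega>) \<le> of_nat (?len r)"
      by (simp only: ennreal_of_nat_eq_real_of_nat)
  qed
  finally have "ennreal (real L * (\<Sum>i<N. 1 / real S ^ i)) / of_nat L \<le> pir_rate S L P d W"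
    unfolding pir_rate_def by (rule divide_right_mono_ennreal)
  moreover have "ennreal (real L * (\<Sum>i<N. 1 / real S ^ i)) / of_nat L
      = ennreal (\<Sum>i<N. 1 / real S ^ i)"
    using L by (simp add: ennreal_of_nat_eq_real_of_nat divide_ennreal sum_nonneg)
  ultimately show ?thesis by simp
qed

section \<open>The run of the algorithm\<close>

lemma g_sum_one: "S \<ge> 2 \<Longrightarrow> g_sum S 1 = 1"
  and f_sum_one: "S \<ge> 2 \<Longrightarrow> f_sum S 1 = 0"
  by (simp_all add: g_sum_def f_sum_def power_int_def field_simps)

lemma g_sum_Suc: "g_sum S (Suc k) = (real S - 1) * f_sum S k"
  by (simp add: g_sum_def f_sum_def)

text \<open>At \<open>k = 1\<close> the exponent \<open>k - 2\<close> is negative; absorbing the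
  factor \<open>S - 1\<close> leaves a natural exponent.\<close>

lemma g_sum_alt:
  assumes "S \<ge> 2" "k \<ge> 1"
  shows "g_sum S k = (- ((-1) ^ k) * (real S - 1) + (real S - 1) ^ (k - 1)) / real S"
proof -
  obtain k' where k: "k = Suc k'" using assms(2) by (cases k) auto
  have "(real S - 1) powi (int k' - 1) * (real S - 1) = (real S - 1) ^ k'"
    using assms(1) by (subst power_int_diff) auto
  then show ?thesis by (simp add: g_sum_def k field_simps)
qed

lemma f_sum_alt:
  assumes "k \<ge> 1"
  shows "f_sum S k = ((-1) ^ k + (real S - 1) ^ (k - 1)) / real S"
proof -
  obtain k' where k: "k = Suc k'" using assms by (cases k) auto
  show ?thesis by (simp add: f_sum_def k)
qed

lemma f_sum_Suc:
  assumes "S \<ge> 2" "k \<ge> 1"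
  shows "f_sum S (Suc k) = g_sum S k + (real S - 2) * f_sum S k"
proof -
  obtain k' where k: "k = Suc k'" using assms by (cases k) auto
  show ?thesis using assms(1)
    by (simp add: f_sum_alt g_sum_alt k field_simps)
qed

text \<open>Integrality is not visible in the closed forms. The recurrences have the natural
  coefficients \<open>S - 1\<close>, \<open>1\<close> and \<open>S - 2\<close>, and they propagate
  it from the values 1 and 0 at \<open>k = 1\<close>.\<close>

lemma g_sum_f_sum_Nats:
  assumes "S \<ge> 2" "k \<ge> 1"
  shows "g_sum S k \<in> \<nat> \<and> f_sum S k \<in> \<nat>"
  using assms(2)
proof (induction k rule: dec_induct)
  case base
  then show ?case using assms(1) by (simp add: g_sum_one[simplified] f_sum_one[simplified])
next
  case (step k)
  have "real S - 1 = real (S - 1)" "real S - 2 = real (S - 2)" using assms(1) by auto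
  with step show ?case
    by (simp add: g_sum_Suc f_sum_Suc assms(1) del: of_nat_diff)
qed

lemma real_phi:
  assumes "S \<ge> 2" "k \<ge> 1"
  shows "real (phi i S k) = (if i = 1 then g_sum S k else f_sum S k)"
  using g_sum_f_sum_Nats[OF assms] by (auto simp: phi_def elim!: Nats_cases)

lemma phi_one: "S \<ge> 2 \<Longrightarrow> phi i S 1 = (if i = 1 then 1 else 0)"
  by (simp add: phi_def g_sum_one[simplified] f_sum_one[simplified])

lemma g_sum_plus_f_sum:
  assumes "S \<ge> 2" "k \<ge> 1"
  shows "g_sum S k + (real S - 1) * f_sum S k = (real S - 1) ^ (k - 1)"
  using assms by (simp add: f_sum_alt g_sum_alt field_simps)

lemma sum_phi:
  assumes "S \<ge> 2" "k \<ge> 1"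
  shows "(\<Sum>j=1..S. phi j S k) = (S - 1) ^ (k - 1)"
proof -
  have "real (\<Sum>j=1..S. phi j S k) = (\<Sum>j=1..S. if j = 1 then g_sum S k else f_sum S k)"
    using assms by (simp add: real_phi)
  also have "\<dots> = g_sum S k + (\<Sum>j\<in>{1..S} - {1}. f_sum S k)"
    using assms(1) by (subst sum.remove[of _ 1]) (auto intro!: sum.cong)
  also have "\<dots> = g_sum S k + (real S - 1) * f_sum S k"
    using assms(1) by simp
  also have "\<dots> = real ((S - 1) ^ (k - 1))"
    using assms by (simp add: g_sum_plus_f_sum)
  finally show ?thesis by (simp only: of_nat_eq_iff)
qed

text \<open>An account of side information: for one demand-free type of size \<open>k\<close>, the
  other databases together hold exactly as many sums as database \<open>j\<close> must contain of
  each type of size \<open>k + 1\<close>.\<close>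

lemma sum_phi_others:
  assumes "S \<ge> 2" "k \<ge> 1" "j \<in> {1..S}"
  shows "(\<Sum>i\<in>{1..S} - {j}. phi i S k) = phi j S (Suc k)"
proof -
  have "(\<Sum>i=1..S. phi i S k) = phi j S k + (\<Sum>i\<in>{1..S} - {j}. phi i S k)"
    using assms(3) by (intro sum.remove) auto
  then have "real ((S - 1) ^ (k - 1))
      = real (phi j S k) + real (\<Sum>i\<in>{1..S} - {j}. phi i S k)"
    using assms by (simp only: sum_phi of_nat_add)
  moreover have "real ((S - 1) ^ (k - 1)) = g_sum S k + (real S - 1) * f_sum S k"
    using assms by (simp add: g_sum_plus_f_sum)
  moreover have "real (phi j S (Suc k)) = (if j = 1 then (real S - 1) * f_sum S k
      else g_sum S k + (real S - 2) * f_sum S k)"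
    using assms by (simp add: real_phi g_sum_Suc f_sum_Suc)
  ultimately have "real (\<Sum>i\<in>{1..S} - {j}. phi i S k) = real (phi j S (Suc k))"
    using real_phi[OF assms(1,2), of j] by (cases "j = 1") (simp_all only: if_True if_False, simp_all add: algebra_simps)
  then show ?thesis by (simp only: of_nat_eq_iff)
qed

section \<open>Counting in lists and in families of subsets\<close>

lemma sum_Pow_power_card:
  assumes "finite A"
  shows "(\<Sum>X\<in>Pow A. x ^ card X) = (1 + x :: 'a :: comm_semiring_1) ^ card A"
  using prod_add[OF assms, of "\<lambda>_. x" "\<lambda>_. 1"] by (simp add: add.commute)

lemma concat_map_filter: "concat (map (\<lambda>x. if P x then [x] else []) xs) = filter P xs"
  by (induction xs) auto

lemma concat_map_if: "concat (map (\<lambda>x. if P x then f x else []) xs) = concat (map f (filter P xs))"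
  by (induction xs) auto

lemma side_information_eq:
  "side_information S d k j st =
     concat (map (\<lambda>i. filter (\<lambda>Q. card Q = k - 1 \<and> d \<notin> fst ` Q) (collection st i))
       (filter (\<lambda>i. i \<noteq> j) [1..<Suc S]))"
  unfolding side_information_def concat_map_filter concat_map_if ..

lemma set_side_information:
  "Q \<in> set (side_information S d k j st) \<longleftrightarrow>
     (\<exists>i\<in>{1..S} - {j}. Q \<in> set (collection st i)) \<and> card Q = k - 1 \<and> d \<notin> fst ` Q"
  unfolding side_information_eq by auto

lemma sorted_wrt_concat_map:
  assumes "distinct is" "\<And>i. i \<in> set is \<Longrightarrow> sorted_wrt P (f i)"
    and "\<And>i i' x y. i \<in> set is \<Longrightarrow> i' \<in> set is \<Longrightarrow> i \<noteq> i' \<Longrightarrow> x \<in> set (f i) \<Longrightarrow> y \<in> set (f i') \<Longrightarrow> P x y"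
  shows "sorted_wrt P (concat (map f is))"
  using assms
proof (induction "is")
  case (Cons i "is")
  have "sorted_wrt P (concat (map f is))"
  proof (rule Cons.IH)
    show "P x y" if "i \<in> set is" "i' \<in> set is" "i \<noteq> i'" "x \<in> set (f i)" "y \<in> set (f i')"
      for i i' x y
      using that by (intro Cons.prems(3)[of i i']) auto
  qed (use Cons.prems in auto)
  moreover have "\<forall>x\<in>set (f i). \<forall>y\<in>set (concat (map f is)). P x y"
    using Cons.prems(1) by (auto intro!: Cons.prems(3)[of i]) 
  ultimately show ?case using Cons.prems(2)[of i] by (auto simp: sorted_wrt_append)
qed simp

lemma count_list_concat_map: "count_list (concat (map f is)) x = (\<Sum>i\<leftarrow>is. count_list (f i) x)"
  by (induction "is") auto

lemma length_filter_eq_sum_count_list: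
  assumes "finite X" "set (filter P xs) \<subseteq> X"
  shows "length (filter P xs) = (\<Sum>x\<in>{x\<in>X. P x}. count_list xs x)"
proof -
  have "length (filter P xs) = (\<Sum>x\<in>{x\<in>X. P x}. count_list (filter P xs) x)"
    using assms by (intro sum_count_set[symmetric]) auto
  also have "\<dots> = (\<Sum>x\<in>{x\<in>X. P x}. count_list xs x)"
  proof (rule sum.cong[OF refl])
    fix x assume "x \<in> {x\<in>X. P x}"
    then show "count_list (filter P xs) x = count_list xs x" by (induction xs) auto
  qed
  finally show ?thesis .
qed

lemma set_other_file_subsets:
  "set (other_file_subsets N d k) = {K. K \<subseteq> {1..N} - {d} \<and> card K = k}"
proof -
  let ?xs = "filter (\<lambda>i. i \<noteq> d) [1..<Suc N]"
  have dist: "distinct ?xs" by simp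
  have "card (set is) = length is" if "is \<in> set (List.subseqs ?xs)" for "is"
    using subseqs_distinctD[OF that dist] by (rule distinct_card)
  then have "set (other_file_subsets N d k) = {K \<in> set ` set (List.subseqs ?xs). card K = k}"
    by (auto simp: other_file_subsets_def)
  also have "\<dots> = {K. K \<subseteq> {1..N} - {d} \<and> card K = k}"
    unfolding subseqs_powset by auto
  finally show ?thesis .
qed

lemma distinct_other_file_subsets: "distinct (other_file_subsets N d k)"
  unfolding other_file_subsets_def
  by (intro distinct_map_filter distinct_set_subseqs) simp

section \<open>Invariants of a run with identity indices\<close>

abbreviation unpermuted :: "nat \<Rightarrow> nat \<Rightarrow> nat" where "unpermuted \<equiv> (\<lambda>_ m. m)"

text \<open>Injectivity of \<open>fst\<close> encodes that the files are distinct. The bound by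
  \<open>t\<close>, used with the counters, makes the next index of every file fresh with respect to
  all queries sent so far.\<close>

definition wf_query :: "nat \<Rightarrow> (nat \<Rightarrow> nat) \<Rightarrow> sum_query \<Rightarrow> bool" where
  "wf_query N t Q \<longleftrightarrow> finite Q \<and> Q \<noteq> {} \<and> inj_on fst Q \<and> fst ` Q \<subseteq> {1..N}
     \<and> (\<forall>p\<in>Q. 1 \<le> snd p \<and> snd p \<le> t (fst p))"

text \<open>The first alternative covers the single subfile sent at the start, the second a demand
  sum together with its side information.\<close>

definition decodable :: "nat \<Rightarrow> nat \<Rightarrow> (nat \<Rightarrow> sum_query list) \<Rightarrow> nat \<Rightarrow> bool" where
  "decodable S d C m \<longleftrightarrow> (\<exists>j\<in>{1..S}. {(d, m)} \<in> set (C j)) \<or>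
     (\<exists>i\<in>{1..S}. \<exists>j\<in>{1..S}. \<exists>Q\<in>set (C i). d \<notin> fst ` Q \<and> insert (d, m) Q \<in> set (C j))"

text \<open>
  The queries whose generation increased the counter of file \<open>i\<close>: a sum containing the demand reuses
  the indices of its side information.
\<close>

definition counted :: "nat \<Rightarrow> nat \<Rightarrow> sum_query \<Rightarrow> bool" where
  "counted d i Q \<longleftrightarrow> i \<in> fst ` Q \<and> (i = d \<or> d \<notin> fst ` Q)"

text \<open>
  The third clause says that a sum without the demand meets a query to another database only where
  it serves as side information.
\<close>

definition run_inv :: "nat \<Rightarrow> nat \<Rightarrow> nat \<Rightarrow> query_state \<Rightarrow> bool" where
  "run_inv S N d st \<longleftrightarrow>
     (\<forall>j. \<forall>Q\<in>set (collection st j). wf_query N (counter st) Q) \<and>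
     (\<forall>j. sorted_wrt (\<lambda>Q Q'. Q \<inter> Q' = {}) (collection st j)) \<and>
     (\<forall>i j Q Q'. i \<noteq> j \<longrightarrow> Q \<in> set (collection st i) \<longrightarrow> Q' \<in> set (collection st j) \<longrightarrow>
        d \<notin> fst ` Q \<longrightarrow> Q \<inter> Q' = {} \<or> d \<in> fst ` Q' \<and> card Q' = Suc (card Q)) \<and>
     (\<forall>i\<in>{1..N}. counter st i
        = (\<Sum>j=1..S. length (filter (counted d i) (collection st j)))) \<and>
     (\<forall>m\<in>{1..counter st d}. decodable S d (collection st) m)"

lemma run_invD:
  assumes "run_inv S N d st"
  shows "\<And>j Q. Q \<in> set (collection st j) \<Longrightarrow> wf_query N (counter st) Q"
    and "\<And>j. sorted_wrt (\<lambda>Q Q'. Q \<inter> Q' = {}) (collection st j)"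
    and "\<And>i j Q Q'. i \<noteq> j \<Longrightarrow> Q \<in> set (collection st i) \<Longrightarrow> Q' \<in> set (collection st j) \<Longrightarrow>
        d \<notin> fst ` Q \<Longrightarrow> Q \<inter> Q' = {} \<or> d \<in> fst ` Q' \<and> card Q' = Suc (card Q)"
    and "\<And>i. i \<in> {1..N} \<Longrightarrow> counter st i
        = (\<Sum>j=1..S. length (filter (counted d i) (collection st j)))"
    and "\<And>m. m \<in> {1..counter st d} \<Longrightarrow> decodable S d (collection st) m"
  using assms unfolding run_inv_def by blast+

lemma decodable_mono:
  assumes "decodable S d C m" "\<And>j. set (C j) \<subseteq> set (C' j)"
  shows "decodable S d C' m"
  using assms unfolding decodable_def by blast

lemma wf_query_mono:
  assumes "wf_query N t Q" "\<And>i. t i \<le> t' i"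
  shows "wf_query N t' Q"
  using assms unfolding wf_query_def by (meson order_trans)

lemma sorted_wrt_disjoint_cases:
  assumes "sorted_wrt (\<lambda>Q Q'. Q \<inter> Q' = {}) xs" "A \<in> set xs" "B \<in> set xs"
  shows "A = B \<or> A \<inter> B = {}"
  using assms by (induction xs) auto

lemma sum_length_filter_append:
  assumes "j \<in> {1..S :: nat}"
  shows "(\<Sum>j'=1..S. length (filter P ((C(j := C j @ [Q])) j')))
       = (\<Sum>j'=1..S. length (filter P (C j'))) + (if P Q then 1 else 0)"
proof -
  have "(\<Sum>j'=1..S. length (filter P ((C(j := C j @ [Q])) j')))
      = (\<Sum>j'=1..S. length (filter P (C j')) + (if j' = j then if P Q then 1 else 0 else 0))"
    by (intro sum.cong) auto
  then show ?thesis using assms by (simp add: sum.distrib sum.delta)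
qed

lemma add_demand_sum_inv:
  assumes inv: "run_inv S N d st" and "d \<in> {1..N}" and j: "j \<in> {1..S}"
    and i: "i \<in> {1..S}" "i \<noteq> j" and Q: "Q \<in> set (collection st i)" "d \<notin> fst ` Q"
    and disj: "\<And>Q'. Q' \<in> set (collection st j) \<Longrightarrow> Q \<inter> Q' = {}"
  shows "run_inv S N d (add_demand_sum unpermuted d j Q st)"
proof -
  note inv = run_invD[OF inv]
  let ?t = "counter st d + 1"
  let ?st = "add_demand_sum unpermuted d j Q st"
  let ?Q = "insert (d, ?t) Q"
  have coll: "collection ?st = (collection st)(j := collection st j @ [?Q])"
    and cnt: "counter ?st = (counter st)(d := ?t)"
    by (simp_all add: add_demand_sum_def Let_def)
  have wfQ: "wf_query N (counter st) Q" using inv(1) Q(1) .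
  have notin: "(d, ?t) \<notin> Q'" if "Q' \<in> set (collection st j')" for Q' j'
    using inv(1)[OF that] by (force simp: wf_query_def)
  have card: "card ?Q = Suc (card Q)"
    using wfQ notin[OF Q(1)] by (simp add: wf_query_def)
  show ?thesis unfolding run_inv_def
  proof (intro conjI allI impI ballI)
    fix j' Q' assume Q': "Q' \<in> set (collection ?st j')"
    have "wf_query N (counter ?st) ?Q"
      using wfQ Q(2) \<open>d \<in> {1..N}\<close> by (force simp: wf_query_def cnt)
    moreover have "wf_query N (counter ?st) Q'" if "Q' \<in> set (collection st j')"
      by (rule wf_query_mono[OF inv(1)[OF that]]) (simp add: cnt)
    ultimately show "wf_query N (counter ?st) Q'"
      using Q' by (auto simp: coll split: if_splits)
  next
    fix j'
    have "Q' \<inter> ?Q = {}" if "Q' \<in> set (collection st j)" for Q'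
      using notin[OF that] disj[OF that] by blast
    then show "sorted_wrt (\<lambda>Q Q'. Q \<inter> Q' = {}) (collection ?st j')"
      using inv(2) by (simp add: coll sorted_wrt_append)
  next
    fix i' j' Q1 Q2
    assume ne: "i' \<noteq> j'" and Q1: "Q1 \<in> set (collection ?st i')"
      and Q2: "Q2 \<in> set (collection ?st j')" and dQ1: "d \<notin> fst ` Q1"
    have Q1': "Q1 \<in> set (collection st i')"
      using Q1 dQ1 by (auto simp: coll split: if_splits)
    show "Q1 \<inter> Q2 = {} \<or> d \<in> fst ` Q2 \<and> card Q2 = Suc (card Q1)"
    proof (cases "Q2 \<in> set (collection st j')")
      case True
      with inv(3)[OF ne Q1'] dQ1 show ?thesis by blast
    next
      case False
      then have Q2': "Q2 = ?Q" and "j' = j" using Q2 by (auto simp: coll split: if_splits)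
      \<comment> \<open>The new element is fresh, so \<open>Q1\<close> can meet the new sum only
        inside \<open>Q\<close>. If \<open>Q1 = Q\<close>, the new sum is larger by one element and
        contains the demand, which is the exception that the invariant admits.\<close>
      have "Q1 = Q \<or> Q1 \<inter> Q = {}"
      proof (cases "i' = i")
        case True
        then show ?thesis using sorted_wrt_disjoint_cases[OF inv(2)[of i]] Q1' Q(1) by blast
      next
        case False
        then show ?thesis using inv(3)[OF False Q1' Q(1)] dQ1 Q(2) by blast
      qed
      then show ?thesis using card Q2' notin[OF Q1'] by auto
    qed
  next
    fix f assume f: "f \<in> {1..N}"
    \<comment> \<open>The files of the side information were counted when \<open>Q\<close> was
      created.\<close>
    have "counted d f ?Q \<longleftrightarrow> f = d"
      by (auto simp: counted_def)
    then show "counter ?st f = (\<Sum>j=1..S. length (filter (counted d f) (collection ?st j)))"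
      unfolding coll sum_length_filter_append[OF j] using inv(4)[OF f]
      by (cases "f = d") (simp_all add: cnt)
  next
    fix m assume m: "m \<in> {1..counter ?st d}"
    show "decodable S d (collection ?st) m"
    proof (cases "m = ?t")
      case True
      have "Q \<in> set (collection ?st i)" "?Q \<in> set (collection ?st j)"
        using Q(1) i(2) by (simp_all add: coll)
      then show ?thesis using True Q(2) i(1) j unfolding decodable_def by blast
    next
      case False
      then have "m \<in> {1..counter st d}" using m by (simp add: cnt)
      then show ?thesis by (intro decodable_mono[OF inv(5)]) (auto simp: coll)
    qed
  qed
qed

text \<open>All indices of the new sum are fresh, so it is disjoint from every earlier query to
  every database.\<close>

lemma add_fresh_sum_inv:
  assumes inv: "run_inv S N d st" and j: "j \<in> {1..S}" and K: "K \<subseteq> {1..N} - {d}" "K \<noteq> {}"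
  shows "run_inv S N d (add_fresh_sum unpermuted j K st)"
proof -
  note inv = run_invD[OF inv]
  let ?t = "\<lambda>i. if i \<in> K then counter st i + 1 else counter st i"
  let ?st = "add_fresh_sum unpermuted j K st"
  let ?Q = "(\<lambda>i. (i, ?t i)) ` K"
  have coll: "collection ?st = (collection st)(j := collection st j @ [?Q])"
    and cnt: "counter ?st = ?t"
    by (simp_all add: add_fresh_sum_def Let_def)
  have fstQ: "fst ` ?Q = K" by (simp add: image_image)
  have finK: "finite K" using K(1) finite_subset by blast
  have disj: "?Q \<inter> Q' = {}" if "Q' \<in> set (collection st j')" for Q' j'
    using inv(1)[OF that] by (force simp: wf_query_def)
  show ?thesis unfolding run_inv_def
  proof (intro conjI allI impI ballI)
    fix j' Q' assume Q': "Q' \<in> set (collection ?st j')"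
    have "wf_query N (counter ?st) ?Q"
      using K finK unfolding wf_query_def fstQ cnt by (auto simp: inj_on_def)
    moreover have "wf_query N (counter ?st) Q'" if "Q' \<in> set (collection st j')"
      by (rule wf_query_mono[OF inv(1)[OF that]]) (simp add: cnt)
    ultimately show "wf_query N (counter ?st) Q'"
      using Q' by (auto simp: coll split: if_splits)
  next
    fix j'
    have "Q' \<inter> ?Q = {}" if "Q' \<in> set (collection st j)" for Q'
      using disj[OF that] by blast
    then show "sorted_wrt (\<lambda>Q Q'. Q \<inter> Q' = {}) (collection ?st j')"
      using inv(2) by (simp add: coll sorted_wrt_append)
  next
    fix i' j' Q1 Q2
    assume ne: "i' \<noteq> j'" and Q1: "Q1 \<in> set (collection ?st i')"
      and Q2: "Q2 \<in> set (collection ?st j')" and dQ1: "d \<notin> fst ` Q1"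
    have "Q1 = ?Q \<and> i' = j \<or> Q1 \<in> set (collection st i')"
      and "Q2 = ?Q \<and> j' = j \<or> Q2 \<in> set (collection st j')"
      using Q1 Q2 by (auto simp: coll split: if_splits)
    then consider "Q1 = ?Q" "Q2 \<in> set (collection st j')"
      | "Q2 = ?Q" "Q1 \<in> set (collection st i')"
      | "Q1 \<in> set (collection st i')" "Q2 \<in> set (collection st j')"
      using ne by blast
    then show "Q1 \<inter> Q2 = {} \<or> d \<in> fst ` Q2 \<and> card Q2 = Suc (card Q1)"
    proof cases
      case 1
      from disj[OF 1(2)] show ?thesis unfolding 1(1) by (rule disjI1)
    next
      case 2
      from disj[OF 2(2)] show ?thesis unfolding 2(1) Int_commute[of Q1] by (rule disjI1)
    next
      case 3
      from inv(3)[OF ne 3 dQ1] show ?thesis .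
    qed
  next
    fix f assume f: "f \<in> {1..N}"
    have "counted d f ?Q \<longleftrightarrow> f \<in> K"
      using K(1) unfolding counted_def fstQ by auto
    then show "counter ?st f = (\<Sum>j=1..S. length (filter (counted d f) (collection ?st j)))"
      unfolding coll sum_length_filter_append[OF j] using inv(4)[OF f] by (simp add: cnt)
  next
    fix m assume "m \<in> {1..counter ?st d}"
    moreover have "d \<notin> K" using K(1) by blast
    ultimately have "m \<in> {1..counter st d}" by (simp add: cnt)
    then show "decodable S d (collection ?st) m"
      by (intro decodable_mono[OF inv(5)]) (auto simp: coll)
  qed
qed

text \<open>Pairwise disjointness of \<open>Qs\<close> keeps the induction going: the remaining side
  queries avoid the part \<open>Q\<close> of the sum just added, and being demand-free they avoid
  its new element.\<close>

lemma fold_add_demand_sum_inv: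
  assumes "run_inv S N d st" "d \<in> {1..N}" "j \<in> {1..S}"
    and "\<And>Q. Q \<in> set Qs \<Longrightarrow> d \<notin> fst ` Q \<and> (\<exists>i\<in>{1..S} - {j}. Q \<in> set (collection st i)) \<and>
           (\<forall>Q'\<in>set (collection st j). Q \<inter> Q' = {})"
    and "sorted_wrt (\<lambda>Q Q'. Q \<inter> Q' = {}) Qs"
  shows "run_inv S N d (fold (add_demand_sum unpermuted d j) Qs st)"
  using assms
proof (induction Qs arbitrary: st)
  case (Cons Q Qs)
  let ?st = "add_demand_sum unpermuted d j Q st"
  have coll: "collection ?st
      = (collection st)(j := collection st j @ [insert (d, counter st d + 1) Q])"
    by (simp add: add_demand_sum_def Let_def)
  obtain i where i: "i \<in> {1..S} - {j}" "Q \<in> set (collection st i)"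
    using Cons.prems(4)[of Q] unfolding list.set by blast
  have inv: "run_inv S N d ?st"
    using Cons.prems i by (intro add_demand_sum_inv[where i = i]) auto
  have "run_inv S N d (fold (add_demand_sum unpermuted d j) Qs ?st)"
  proof (rule Cons.IH[OF inv])
    fix Q' assume Q': "Q' \<in> set Qs"
    then have hyp: "d \<notin> fst ` Q'" "\<exists>i\<in>{1..S} - {j}. Q' \<in> set (collection st i)"
      "\<forall>Q''\<in>set (collection st j). Q' \<inter> Q'' = {}" "Q \<inter> Q' = {}"
      using Cons.prems(4)[of Q'] Cons.prems(5) by auto
    have "Q' \<inter> insert (d, counter st d + 1) Q = {}" using hyp(1,4) by force
    with hyp show "d \<notin> fst ` Q' \<and> (\<exists>i\<in>{1..S} - {j}. Q' \<in> set (collection ?st i)) \<and>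
        (\<forall>Q''\<in>set (collection ?st j). Q' \<inter> Q'' = {})"
      by (auto simp: coll)
  qed (use Cons.prems in auto)
  then show ?case by simp
qed simp

lemma funpow_add_fresh_sum_inv:
  assumes "run_inv S N d st" "j \<in> {1..S}" "K \<subseteq> {1..N} - {d}" "K \<noteq> {}"
  shows "run_inv S N d ((add_fresh_sum unpermuted j K ^^ n) st)"
proof (induction n)
  case (Suc n)
  then show ?case using add_fresh_sum_inv[OF _ assms(2-)] by simp
qed (use assms(1) in simp)

lemma fold_add_fresh_sum_inv:
  assumes "run_inv S N d st" "j \<in> {1..S}" "\<And>K. K \<in> set Ks \<Longrightarrow> K \<subseteq> {1..N} - {d} \<and> K \<noteq> {}"
  shows "run_inv S N d (fold (\<lambda>K. add_fresh_sum unpermuted j K ^^ n) Ks st)"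
  using assms(1,3)
proof (induction Ks arbitrary: st)
  case (Cons K Ks)
  then show ?case
    using funpow_add_fresh_sum_inv[of S N d st j K n] assms(2) by simp
qed simp

section \<open>Number of sums of each type\<close>

definition types :: "query_state \<Rightarrow> nat \<Rightarrow> nat set list" where
  "types st j = map (image fst) (collection st j)"

lemma types_fold_add_demand_sum:
  "types (fold (add_demand_sum a d j) Qs st) =
     (types st)(j := types st j @ map (\<lambda>Q. insert d (fst ` Q)) Qs)"
proof (induction Qs arbitrary: st)
  case (Cons Q Qs)
  show ?case
    by (rule ext) (simp add: Cons.IH, simp add: types_def add_demand_sum_def Let_def)
qed simp

lemma types_funpow_add_fresh_sum:
  "types ((add_fresh_sum a j K ^^ n) st) = (types st)(j := types st j @ replicate n K)"
proof (induction n)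
  case (Suc n)
  show ?case
    by (rule ext) (use Suc in \<open>simp add: types_def add_fresh_sum_def Let_def image_image
      replicate_append_same fun_eq_iff\<close>)
qed simp

lemma types_fold_add_fresh_sum:
  "types (fold (\<lambda>K. add_fresh_sum a j K ^^ n) Ks st) =
     (types st)(j := types st j @ concat (map (replicate n) Ks))"
proof (induction Ks arbitrary: st)
  case (Cons K Ks)
  show ?case by (rule ext) (simp add: Cons.IH types_funpow_add_fresh_sum)
qed simp

text \<open>\<open>thr j\<close> bounds the sizes generated so far in database \<open>j\<close>: in
  the middle of a round it is \<open>k + 1\<close> for the processed databases and \<open>k\<close>
  for the others. The demand does not occur in this condition, which is what privacy rests
  on.\<close>

definition type_counts :: "nat \<Rightarrow> nat \<Rightarrow> (nat \<Rightarrow> nat) \<Rightarrow> query_state \<Rightarrow> bool" where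
  "type_counts S N thr st \<longleftrightarrow> (\<forall>j\<in>{1..S}. \<forall>K. K \<noteq> {} \<longrightarrow> K \<subseteq> {1..N} \<longrightarrow>
     count_list (types st j) K = (if card K < thr j then phi j S (card K) else 0))"

lemma type_countsD:
  assumes "type_counts S N thr st" "j \<in> {1..S}" "K \<noteq> {}" "K \<subseteq> {1..N}"
  shows "count_list (types st j) K = (if card K < thr j then phi j S (card K) else 0)"
  using assms unfolding type_counts_def by blast

lemma wf_query_card: "wf_query N t Q \<Longrightarrow> card (fst ` Q) = card Q"
  unfolding wf_query_def by (blast intro: card_image)

lemma card_less_threshold:
  assumes "run_inv S N d st" "type_counts S N thr st" "j \<in> {1..S}" "Q \<in> set (collection st j)"
  shows "card Q < thr j"
proof -
  have wf: "wf_query N (counter st) Q" using run_invD(1)[OF assms(1,4)] .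
  have "fst ` Q \<in> set (types st j)" using assms(4) by (simp add: types_def)
  then have "count_list (types st j) (fst ` Q) \<noteq> 0" by (simp add: count_list_0_iff)
  then show ?thesis
    using type_countsD[OF assms(2,3), of "fst ` Q"] wf wf_query_card[OF wf]
    by (auto simp: wf_query_def split: if_splits)
qed

lemma count_list_map: "count_list (map f xs) y = length (filter (\<lambda>x. f x = y) xs)"
  by (induction xs) auto

lemma count_list_side_information:
  assumes inv: "run_inv S N d st" and K: "d \<notin> K" "card K = k - 1"
  shows "count_list (map (image fst) (side_information S d k j st)) K
       = (\<Sum>i\<in>{1..S} - {j}. count_list (types st i) K)"
proof -
  have "count_list (map (image fst) (filter (\<lambda>Q. card Q = k - 1 \<and> d \<notin> fst ` Q) (collection st i))) K
      = count_list (types st i) K" for i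
  proof -
    have "card Q = k - 1 \<and> d \<notin> fst ` Q" if "Q \<in> set (collection st i)" "fst ` Q = K" for Q
      using that K wf_query_card[OF run_invD(1)[OF inv that(1)]] by simp
    then show ?thesis unfolding types_def count_list_map filter_filter
      by (intro arg_cong[where f = length] filter_cong) blast+
  qed
  then have "count_list (map (image fst) (side_information S d k j st)) K
      = (\<Sum>i\<leftarrow>filter (\<lambda>i. i \<noteq> j) [1..<Suc S]. count_list (types st i) K)"
    unfolding side_information_eq map_concat map_map o_def count_list_concat_map by simp
  also have "\<dots> = (\<Sum>i\<in>{1..S} - {j}. count_list (types st i) K)"
    by (subst sum_list_distinct_conv_sum_set) (auto intro: sum.cong)
  finally show ?thesis .
qed

text \<open>A type \<open>K\<close> of size \<open>k\<close> with \<open>d \<in> K\<close> arises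
  from the side information of type \<open>K - {d}\<close>, one without \<open>d\<close> from the
  repetitions of fresh sums; \<open>sum_phi_others\<close> makes both numbers equal. The other
  databases may have threshold \<open>k\<close> or \<open>k + 1\<close>, since only their sums of
  size \<open>k - 1\<close> are read.\<close>

lemma process_database_inv:
  assumes S: "S \<ge> 2" and k: "k \<ge> 2" and d: "d \<in> {1..N}" and j: "j \<in> {1..S}"
    and inv: "run_inv S N d st" and tc: "type_counts S N thr st"
    and thr: "thr j = k" "\<And>i. i \<in> {1..S} \<Longrightarrow> thr i \<in> {k, Suc k}"
  shows "run_inv S N d (process_database S N unpermuted d k j st)"
    and "type_counts S N (thr(j := Suc k)) (process_database S N unpermuted d k j st)"
proof -
  let ?side = "side_information S d k j st"
  let ?D = "\<lambda>Q Q' :: sum_query. Q \<inter> Q' = {}"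
  define st1 where "st1 = fold (add_demand_sum unpermuted d j) ?side st"
  define F where "F = (if ?side = [] then [] else other_file_subsets N d k)"
  have out: "process_database S N unpermuted d k j st
      = fold (\<lambda>K. add_fresh_sum unpermuted j K ^^ phi j S k) F st1"
    by (simp add: process_database_def Let_def st1_def F_def)

  have "run_inv S N d st1" unfolding st1_def
  proof (rule fold_add_demand_sum_inv[OF inv d j])
    fix Q assume Q: "Q \<in> set ?side"
    then obtain i where i: "i \<in> {1..S} - {j}" "Q \<in> set (collection st i)"
      and cardQ: "card Q = k - 1" "d \<notin> fst ` Q"
      unfolding set_side_information by blast
    \<comment> \<open>The exception in the invariant would need a \<open>k\<close>-sum in database
      \<open>j\<close>, but before its turn this database holds only smaller sums.\<close>
    have "Q \<inter> Q' = {}" if Q': "Q' \<in> set (collection st j)" for Q'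
      using run_invD(3)[OF inv _ i(2) Q' cardQ(2)] card_less_threshold[OF inv tc j Q'] i(1)
        thr(1) cardQ(1) k by auto
    with i cardQ show "d \<notin> fst ` Q \<and> (\<exists>i\<in>{1..S} - {j}. Q \<in> set (collection st i)) \<and>
        (\<forall>Q'\<in>set (collection st j). Q \<inter> Q' = {})" by blast
  next
    show "sorted_wrt ?D ?side" unfolding side_information_eq
    proof (rule sorted_wrt_concat_map)
      show "sorted_wrt ?D (filter (\<lambda>Q. card Q = k - 1 \<and> d \<notin> fst ` Q) (collection st i))" for i
        using run_invD(2)[OF inv] by (rule sorted_wrt_filter)
      show "Q \<inter> Q' = {}" if "i \<noteq> i'"
        "Q \<in> set (filter (\<lambda>Q. card Q = k - 1 \<and> d \<notin> fst ` Q) (collection st i))"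
        "Q' \<in> set (filter (\<lambda>Q. card Q = k - 1 \<and> d \<notin> fst ` Q) (collection st i'))" for i i' Q Q'
        using run_invD(3)[OF inv that(1), of Q Q'] that(2,3) by auto
    qed simp
  qed
  moreover have F: "K \<subseteq> {1..N} - {d} \<and> K \<noteq> {}" if "K \<in> set F" for K
    using that k by (auto simp: F_def set_other_file_subsets split: if_splits)
  ultimately show "run_inv S N d (process_database S N unpermuted d k j st)"
    unfolding out using fold_add_fresh_sum_inv[OF _ j] by blast

  have types: "types (process_database S N unpermuted d k j st) =
      (types st)(j := types st j @ map (\<lambda>Q. insert d (fst ` Q)) ?side
        @ concat (map (replicate (phi j S k)) F))"
    unfolding out types_fold_add_fresh_sum unfolding st1_def types_fold_add_demand_sum by simp
  have side_count: "(\<Sum>i\<in>{1..S} - {j}. count_list (types st i) K) = phi j S k"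
    if K: "K \<subseteq> {1..N}" "K \<noteq> {}" "card K = k - 1" for K
  proof -
    have "count_list (types st i) K = phi i S (k - 1)" if "i \<in> {1..S} - {j}" for i
      using type_countsD[OF tc _ K(2,1), of i] that thr(2)[of i] K(3) k by auto
    then have "(\<Sum>i\<in>{1..S} - {j}. count_list (types st i) K)
        = (\<Sum>i\<in>{1..S} - {j}. phi i S (k - 1))"
      by (intro sum.cong) auto
    also have "\<dots> = phi j S (Suc (k - 1))"
      using S k j by (intro sum_phi_others) auto
    finally show ?thesis using k by simp
  qed
  have demand: "count_list (map (\<lambda>Q. insert d (fst ` Q)) ?side) K
      = (if card K = k \<and> d \<in> K then phi j S k else 0)"
    if K: "K \<subseteq> {1..N}" "K \<noteq> {}" for K
  proof (cases "card K = k \<and> d \<in> K")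
    case True
    have finK: "finite K" using K(1) finite_subset by blast
    have cardK: "card (K - {d}) = k - 1" using True finK by simp
    then have ne: "K - {d} \<noteq> {}" using k by (intro notI) simp
    have "insert d (fst ` Q) = K \<longleftrightarrow> fst ` Q = K - {d}" if "Q \<in> set ?side" for Q
    proof -
      have "d \<notin> fst ` Q" using that unfolding set_side_information by blast
      with True show ?thesis by auto
    qed
    then have "count_list (map (\<lambda>Q. insert d (fst ` Q)) ?side) K
        = count_list (map (image fst) ?side) (K - {d})"
      unfolding count_list_map by (intro arg_cong[where f = length] filter_cong) auto
    also have "\<dots> = phi j S k"
      using count_list_side_information[OF inv _ cardK] side_count[OF _ ne cardK] K(1) by auto
    finally show ?thesis using True by simp
  next
    case False
    have "insert d (fst ` Q) \<noteq> K" if Q: "Q \<in> set ?side" for Q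
    proof -
      obtain i where i: "Q \<in> set (collection st i)" and Q': "card Q = k - 1" "d \<notin> fst ` Q"
        using Q unfolding set_side_information by blast
      have wf: "wf_query N (counter st) Q" using run_invD(1)[OF inv i] .
      then have "card (insert d (fst ` Q)) = k"
        using Q' k wf_query_card[OF wf] by (simp add: wf_query_def)
      then show ?thesis using False by blast
    qed
    then have "count_list (map (\<lambda>Q. insert d (fst ` Q)) ?side) K = 0"
      by (auto simp: count_list_0_iff)
    with False show ?thesis by (simp only: if_False)
  qed
  have fresh: "count_list (concat (map (replicate (phi j S k)) F)) K
      = (if card K = k \<and> d \<notin> K then phi j S k else 0)"
    if K: "K \<subseteq> {1..N}" "K \<noteq> {}" for K
  proof -
    have dist: "distinct F" by (simp add: F_def distinct_other_file_subsets)
    have "count_list (concat (map (replicate (phi j S k)) F)) K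
        = (\<Sum>K'\<in>set F. if K' = K then phi j S k else 0)"
    proof -
      have "count_list (replicate n x) y = (if x = y then n else 0)" for n and x y :: "nat set"
        by (induction n) auto
      then show ?thesis
        unfolding count_list_concat_map by (simp add: sum_list_distinct_conv_sum_set dist)
    qed
    also have "\<dots> = (if K \<in> set F then phi j S k else 0)" by (simp add: sum.delta)
    also have "\<dots> = (if card K = k \<and> d \<notin> K then phi j S k else 0)"
    \<comment> \<open>The guard of the fresh sums is harmless. A \<open>k\<close>-set
      \<open>K\<close> avoiding \<open>d\<close> has a subset \<open>K0\<close> of size
      \<open>k - 1\<close>, and the side information contains \<open>phi j S k\<close> sums of type
      \<open>K0\<close>; if there is none, this number is 0. For \<open>S = 2\<close> this happens
      to the two databases alternately.\<close>
    proof (cases "?side = []")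
      case True
      have "phi j S k = 0" if K': "card K = k" "d \<notin> K"
      proof -
        obtain K0 where K0: "K0 \<subseteq> K" "card K0 = k - 1"
          using K'(1) by (metis obtain_subset_with_card_n diff_le_self)
        moreover have "K0 \<noteq> {}" using K0 k by (intro notI) simp
        ultimately have "phi j S k = count_list (map (image fst) ?side) K0"
          using count_list_side_information[OF inv, of K0 k j] side_count[of K0] K(1) K'(2)
          by (metis order_trans subsetD)
        then show ?thesis using True by simp
      qed
      with True show ?thesis by (auto simp: F_def)
    next
      case False
      then show ?thesis using K(1) by (auto simp: F_def set_other_file_subsets)
    qed
    finally show ?thesis .
  qed
  show "type_counts S N (thr(j := Suc k)) (process_database S N unpermuted d k j st)"
    unfolding type_counts_def
  proof (intro ballI allI impI)
    fix j' K assume j': "j' \<in> {1..S}" and K: "K \<noteq> {}" "K \<subseteq> {1..N}"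
    show "count_list (types (process_database S N unpermuted d k j st) j') K
        = (if card K < (thr(j := Suc k)) j' then phi j' S (card K) else 0)"
    proof (cases "j' = j")
      case True
      then show ?thesis
        using type_countsD[OF tc j K] demand[OF K(2,1)] fresh[OF K(2,1)] thr(1)
        by (auto simp: types less_Suc_eq)
    next
      case False
      then show ?thesis using type_countsD[OF tc j' K] by (simp add: types)
    qed
  qed
qed

lemma partial_round_inv:
  assumes S: "S \<ge> 2" and k: "k \<ge> 2" and d: "d \<in> {1..N}"
    and inv: "run_inv S N d st" and tc: "type_counts S N (\<lambda>_. k) st"
    and m: "1 \<le> m" "m \<le> Suc S"
  shows "run_inv S N d (fold (process_database S N unpermuted d k) [1..<m] st) \<and>
    type_counts S N (\<lambda>j. if j < m then Suc k else k)
      (fold (process_database S N unpermuted d k) [1..<m] st)"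
  using m
proof (induction m rule: dec_induct)
  case base
  then show ?case using inv tc by (simp add: type_counts_def)
next
  case (step m)
  let ?R = "\<lambda>m. fold (process_database S N unpermuted d k) [1..<m] st"
  let ?thr = "\<lambda>m j. if j < m then Suc k else k"
  from step have IH: "run_inv S N d (?R m)" "type_counts S N (?thr m) (?R m)" and m: "m \<in> {1..S}"
    by auto
  have "?R (Suc m) = process_database S N unpermuted d k m (?R m)"
    using step(1) by simp
  moreover have "(?thr m)(m := Suc k) = ?thr (Suc m)" by (auto simp: fun_eq_iff)
  ultimately show ?case
    using process_database_inv[OF S k d m IH] by simp
qed

lemma process_round_inv:
  assumes "S \<ge> 2" "k \<ge> 2" "d \<in> {1..N}" "run_inv S N d st" "type_counts S N (\<lambda>_. k) st"
  shows "run_inv S N d (process_round S N unpermuted d k st)"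
    and "type_counts S N (\<lambda>_. Suc k) (process_round S N unpermuted d k st)"
proof -
  note * = partial_round_inv[OF assms, of "Suc S", folded process_round_def]
  show "run_inv S N d (process_round S N unpermuted d k st)" using * by simp
  have "type_counts S N (\<lambda>j. if j < Suc S then Suc k else k) (process_round S N unpermuted d k st)"
    using * by simp
  then show "type_counts S N (\<lambda>_. Suc k) (process_round S N unpermuted d k st)"
    by (simp add: type_counts_def less_Suc_eq_le)
qed

lemma initial_state_inv:
  assumes "S \<ge> 2" "d \<in> {1..N}"
  shows "run_inv S N d (initial_state N unpermuted)"
    and "type_counts S N (\<lambda>_. 2) (initial_state N unpermuted)"
proof -
  let ?st = "initial_state N unpermuted"
  let ?qs = "map (\<lambda>i. {(i, 1)}) [1..<Suc N] :: sum_query list"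
  have coll: "collection ?st = (\<lambda>_. [])(1 := ?qs)" and cnt: "counter ?st = (\<lambda>_. 1)"
    by (simp_all add: initial_state_def)
  have length_filter_eq: "length (filter ((=) i) [1..<Suc N]) = 1" if "i \<in> {1..N}" for i
  proof -
    have "{x. i = x} \<inter> set [1..<Suc N] = {i}" using that by auto
    then show ?thesis by (simp only: distinct_length_filter[OF distinct_upt]) simp
  qed
  show "run_inv S N d ?st" unfolding run_inv_def
  proof (intro conjI allI impI ballI)
    show "wf_query N (counter ?st) Q" if "Q \<in> set (collection ?st j)" for j Q
      using that by (auto simp: coll cnt wf_query_def split: if_splits)
    have "sorted_wrt (\<noteq>) [1..<Suc N]"
      by (rule sorted_wrt_mono_rel[OF _ sorted_wrt_upt]) simp
    then show "sorted_wrt (\<lambda>Q Q'. Q \<inter> Q' = {}) (collection ?st j)" for j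
      by (simp add: coll sorted_wrt_map del: upt_Suc)
    show "Q \<inter> Q' = {} \<or> d \<in> fst ` Q' \<and> card Q' = Suc (card Q)"
      if "i \<noteq> j" "Q \<in> set (collection ?st i)" "Q' \<in> set (collection ?st j)" for i j Q Q'
      using that by (auto simp: coll split: if_splits)
    show "counter ?st i = (\<Sum>j=1..S. length (filter (counted d i) (collection ?st j)))"
      if i: "i \<in> {1..N}" for i
    proof -
      have "length (filter (counted d i) ?qs) = length (filter ((=) i) [1..<Suc N])"
        unfolding filter_map length_map o_def by (intro arg_cong[where f = length] filter_cong)
          (auto simp: counted_def)
      then have "(\<Sum>j=1..S. length (filter (counted d i) (collection ?st j)))
          = (\<Sum>j=1..S. if j = 1 then 1 else 0)"
        using length_filter_eq[OF i] by (intro sum.cong) (auto simp: coll)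
      then show ?thesis using assms(1) by (simp add: cnt sum.delta)
    qed
    show "decodable S d (collection ?st) m" if "m \<in> {1..counter ?st d}" for m
      using that assms unfolding decodable_def
      by (intro disjI1 bexI[of _ 1]) (auto simp: coll cnt)
  qed
  show "type_counts S N (\<lambda>_. 2) ?st" unfolding type_counts_def
  proof (intro ballI allI impI)
    fix j K assume j: "j \<in> {1..S}" and K: "K \<noteq> {}" "K \<subseteq> {1..N}"
    have types: "types ?st j = (if j = 1 then map (\<lambda>i. {i}) [1..<Suc N] else [])"
      by (simp add: types_def coll)
    have "finite K" using K(2) finite_subset by blast
    then have pos: "card K > 0" using K(1) by (simp add: card_gt_0_iff)
    show "count_list (types ?st j) K = (if card K < 2 then phi j S (card K) else 0)"
    proof (cases "card K = 1")
      case True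
      then obtain i where i: "K = {i}" by (auto simp: card_1_singleton_iff)
      have "count_list (map (\<lambda>i. {i}) [1..<Suc N]) {i} = length (filter ((=) i) [1..<Suc N])"
        unfolding count_list_eq_length_filter filter_map length_map o_def
        by (intro arg_cong[where f = length] filter_cong) auto
      then show ?thesis
        using length_filter_eq[of i] K(2) i True phi_one[OF assms(1), of j] by (simp add: types)
    next
      case False
      then have "K \<notin> set (types ?st j)" by (auto simp: types)
      then show ?thesis using False pos by (simp add: count_list_0_iff)
    qed
  qed
qed

section \<open>Counters and the total number of sums after all rounds\<close>

text \<open>The loop unrolled to the rounds \<open>2..N\<close>. The counter of the demand reaches
  \<open>S ^ (N - 1)\<close> exactly after round \<open>N\<close>, so no loop test has to be
  evaluated.\<close>

definition final_state :: "nat \<Rightarrow> nat \<Rightarrow> nat \<Rightarrow> query_state" where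
  "final_state S N d = fold (process_round S N unpermuted d) [2..<Suc N] (initial_state N unpermuted)"

lemma rounds_inv:
  assumes S: "S \<ge> 2" and d: "d \<in> {1..N}" and k: "2 \<le> k"
  shows "run_inv S N d (fold (process_round S N unpermuted d) [2..<k] (initial_state N unpermuted))
       \<and> type_counts S N (\<lambda>_. k)
           (fold (process_round S N unpermuted d) [2..<k] (initial_state N unpermuted))"
  using k
proof (induction k rule: dec_induct)
  case base
  then show ?case using initial_state_inv[OF S d] by simp
next
  case (step k)
  then show ?case using process_round_inv[OF S step(1) d] by simp
qed

text \<open>Summing over all databases turns \<open>\<phi>\<^sub>1, \<dots>, \<phi>\<^sub>S\<close> into a power of \<open>S - 1\<close>.\<close>

lemma sum_length_filter_types:
  assumes S: "S \<ge> 2" and inv: "run_inv S N d st" and tc: "type_counts S N (\<lambda>_. k) st"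
  shows "(\<Sum>j=1..S. length (filter (\<lambda>Q. P (fst ` Q)) (collection st j)))
       = (\<Sum>K | K \<noteq> {} \<and> K \<subseteq> {1..N} \<and> P K \<and> card K < k. (S - 1) ^ (card K - 1))"
proof -
  let ?X = "Pow {1..N} - {{}}"
  have "length (filter (\<lambda>Q. P (fst ` Q)) (collection st j))
      = (\<Sum>K\<in>{K\<in>?X. P K}. if card K < k then phi j S (card K) else 0)" if j: "j \<in> {1..S}" for j
  proof -
    have "length (filter (\<lambda>Q. P (fst ` Q)) (collection st j)) = length (filter P (types st j))"
      by (simp add: types_def filter_map o_def)
    also have "\<dots> = (\<Sum>K\<in>{K\<in>?X. P K}. count_list (types st j) K)"
      using run_invD(1)[OF inv]
      by (intro length_filter_eq_sum_count_list) (fastforce simp: types_def wf_query_def)+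
    also have "\<dots> = (\<Sum>K\<in>{K\<in>?X. P K}. if card K < k then phi j S (card K) else 0)"
      using type_countsD[OF tc j] by (intro sum.cong) auto
    finally show ?thesis .
  qed
  then have "(\<Sum>j=1..S. length (filter (\<lambda>Q. P (fst ` Q)) (collection st j)))
      = (\<Sum>j=1..S. \<Sum>K\<in>{K\<in>?X. P K}. if card K < k then phi j S (card K) else 0)"
    by (intro sum.cong) auto
  also have "\<dots> = (\<Sum>K\<in>{K\<in>?X. P K}. \<Sum>j=1..S. if card K < k then phi j S (card K) else 0)"
    by (rule sum.swap)
  also have "\<dots> = (\<Sum>K\<in>{K\<in>?X. P K}. if card K < k then (S - 1) ^ (card K - 1) else 0)"
  proof (rule sum.cong[OF refl])
    fix K assume "K \<in> {K\<in>?X. P K}"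
    then have "card K \<ge> 1" by (auto simp: Suc_le_eq card_gt_0_iff finite_subset)
    then show "(\<Sum>j=1..S. if card K < k then phi j S (card K) else 0)
        = (if card K < k then (S - 1) ^ (card K - 1) else 0)"
      using sum_phi[OF S, of "card K"] by simp
  qed
  also have "\<dots> = (\<Sum>K | K \<noteq> {} \<and> K \<subseteq> {1..N} \<and> P K \<and> card K < k. (S - 1) ^ (card K - 1))"
    by (subst sum.inter_filter[symmetric]) (auto intro: sum.cong)
  finally show ?thesis .
qed

text \<open>Removing \<open>i\<close> from \<open>K\<close> turns the sum into the binomial
  expansion of \<open>1 + (S - 1)\<close> to the power \<open>N - 1\<close>. This is why a file has
  \<open>S ^ (N - 1)\<close> subfiles.\<close>

lemma sum_power_card_containing:
  fixes S N i :: nat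
  assumes S: "S \<ge> 1" and i: "i \<in> {1..N}"
  shows "(\<Sum>K | K \<subseteq> {1..N} \<and> i \<in> K. (S - 1) ^ (card K - 1)) = S ^ (N - 1)"
proof -
  have "(\<Sum>K | K \<subseteq> {1..N} \<and> i \<in> K. (S - 1) ^ (card K - 1))
      = (\<Sum>K\<in>Pow ({1..N} - {i}). (S - 1) ^ card K)"
    using i
    by (intro sum.reindex_bij_witness[of _ "insert i" "\<lambda>K. K - {i}"])
       (auto simp: finite_subset)
  also have "\<dots> = (1 + (S - 1)) ^ card ({1..N} - {i})"
    by (rule sum_Pow_power_card) simp
  finally show ?thesis using assms by simp
qed

lemma counter_eq:
  assumes "S \<ge> 2" "run_inv S N d st" "type_counts S N (\<lambda>_. k) st" "i \<in> {1..N}"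
  shows "counter st i = (\<Sum>K | K \<noteq> {} \<and> K \<subseteq> {1..N} \<and> (i \<in> K \<and> (i = d \<or> d \<notin> K)) \<and> card K < k.
           (S - 1) ^ (card K - 1))"
  using run_invD(4)[OF assms(2,4)] sum_length_filter_types[OF assms(1-3),
      where P = "\<lambda>K. i \<in> K \<and> (i = d \<or> d \<notin> K)"]
  by (simp add: counted_def[abs_def])

text \<open>The types counted for file \<open>i\<close> form a subfamily of the sets containing
  \<open>i\<close>. So the algorithm never runs out of subfiles, also for the files that are not
  demanded.\<close>

lemma counter_le:
  assumes "S \<ge> 2" "run_inv S N d st" "type_counts S N (\<lambda>_. k) st" "i \<in> {1..N}"
  shows "counter st i \<le> S ^ (N - 1)"
proof -
  have "counter st i \<le> (\<Sum>K | K \<subseteq> {1..N} \<and> i \<in> K. (S - 1) ^ (card K - 1))"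
    unfolding counter_eq[OF assms] by (intro sum_mono2) auto
  then show ?thesis using sum_power_card_containing[of S i N] assms by simp
qed

lemma counter_demand_less:
  assumes "S \<ge> 2" "run_inv S N d st" "type_counts S N (\<lambda>_. k) st" "d \<in> {1..N}" "k \<le> N"
  shows "counter st d < S ^ (N - 1)"
proof -
  have "counter st d < (\<Sum>K | K \<subseteq> {1..N} \<and> d \<in> K. (S - 1) ^ (card K - 1))"
    unfolding counter_eq[OF assms(1-4)] using assms
    \<comment> \<open>The strict gap comes from the type \<open>{1..N}\<close>, whose size
      \<open>N\<close> is not below \<open>k\<close>.\<close>
    by (intro sum_strict_mono2[where b = "{1..N}"]) auto
  then show ?thesis using sum_power_card_containing[of S d N] assms by simp
qed

lemma counter_demand_eq:
  assumes "S \<ge> 2" "run_inv S N d st" "type_counts S N (\<lambda>_. Suc N) st" "d \<in> {1..N}"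
  shows "counter st d = S ^ (N - 1)"
proof -
  have "card K < Suc N" if "K \<subseteq> {1..N}" for K
    using card_mono[OF _ that] by simp
  then have "counter st d = (\<Sum>K | K \<subseteq> {1..N} \<and> d \<in> K. (S - 1) ^ (card K - 1))"
    unfolding counter_eq[OF assms] by (intro sum.cong) auto
  then show ?thesis using sum_power_card_containing[of S d N] assms by simp
qed

lemma final_state_inv:
  assumes "S \<ge> 2" "d \<in> {1..N}"
  shows "run_inv S N d (final_state S N d)" "type_counts S N (\<lambda>_. Suc N) (final_state S N d)"
  using rounds_inv[OF assms, of "Suc N"] assms(2) by (simp_all add: final_state_def)

text \<open>Multiplication by \<open>S - 1\<close> raises the exponent \<open>card K - 1\<close> to
  \<open>card K\<close>; the binomial theorem without the empty set then gives
  \<open>S ^ N - 1\<close>, the numerator of the geometric sum.\<close>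

lemma final_total:
  assumes "S \<ge> 2" "d \<in> {1..N}"
  shows "real (\<Sum>j=1..S. length (collection (final_state S N d) j))
       = real (S ^ (N - 1)) * (\<Sum>i<N. 1 / real S ^ i)"
proof -
  have "card K < Suc N" if "K \<subseteq> {1..N}" for K
    using card_mono[OF _ that] by simp
  then have eq: "(\<Sum>j=1..S. length (collection (final_state S N d) j))
      = (\<Sum>K\<in>Pow {1..N} - {{}}. (S - 1) ^ (card K - 1))"
    using sum_length_filter_types[OF assms(1) final_state_inv[OF assms], where P = "\<lambda>_. True"]
    by (auto intro!: sum.cong)
  have "(S - 1) * (\<Sum>K\<in>Pow {1..N} - {{}}. (S - 1) ^ (card K - 1))
      = (\<Sum>K\<in>Pow {1..N} - {{}}. (S - 1) ^ card K)"
    unfolding sum_distrib_left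
  proof (rule sum.cong[OF refl])
    fix K assume "K \<in> Pow {1..N} - {{}}"
    then have "card K > 0" by (auto simp: card_gt_0_iff finite_subset)
    then show "(S - 1) * (S - 1) ^ (card K - 1) = (S - 1) ^ card K"
      by (simp add: power_eq_if)
  qed
  moreover have "(\<Sum>K\<in>Pow {1..N}. (S - 1) ^ card K)
      = 1 + (\<Sum>K\<in>Pow {1..N} - {{}}. (S - 1) ^ card K)"
    by (subst sum.remove[of _ "{}"]) auto
  moreover have "(\<Sum>K\<in>Pow {1..N}. (S - 1) ^ card K) = S ^ N"
    using sum_Pow_power_card[of "{1..N}" "S - 1"] assms(1) by simp
  ultimately have "S ^ N = 1 + (S - 1) * (\<Sum>j=1..S. length (collection (final_state S N d) j))"
    unfolding eq by simp
  then have "real (S ^ N)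
      = real (1 + (S - 1) * (\<Sum>j=1..S. length (collection (final_state S N d) j)))"
    by (rule arg_cong)
  then have total: "real S ^ N - 1
      = (real S - 1) * real (\<Sum>j=1..S. length (collection (final_state S N d) j))"
    using assms(1) by (simp add: algebra_simps)
  have "N = Suc (N - 1)" using assms(2) by simp
  then have pow: "real S ^ N = real S * real S ^ (N - 1)" by (metis power_Suc)
  have "(\<Sum>i<N. 1 / real S ^ i) = (\<Sum>i<N. (1 / real S) ^ i)"
    by (simp add: power_divide)
  also have "\<dots> = ((1 / real S) ^ N - 1) / (1 / real S - 1)"
    using assms(1) by (intro geometric_sum) auto
  also have "\<dots> = (real S ^ N - 1) / ((real S - 1) * real S ^ (N - 1))"
    using assms(1) by (simp add: power_divide pow field_simps)
  finally show ?thesis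
    using assms(1) unfolding total by simp
qed

section \<open>Arbitrary permutations as a renaming\<close>

definition relabel :: "(nat \<Rightarrow> nat \<Rightarrow> nat) \<Rightarrow> nat \<times> nat \<Rightarrow> nat \<times> nat" where
  "relabel a p = (fst p, a (fst p) (snd p))"

definition relabel_state :: "(nat \<Rightarrow> nat \<Rightarrow> nat) \<Rightarrow> query_state \<Rightarrow> query_state" where
  "relabel_state a st =
     \<lparr>collection = (\<lambda>j. map (image (relabel a)) (collection st j)), counter = counter st\<rparr>"

lemma fst_relabel: "fst ` relabel a ` Q = fst ` Q"
  by (simp add: image_image relabel_def)

lemma card_relabel:
  assumes "inj_on fst Q"
  shows "card (relabel a ` Q) = card Q"
  using assms by (intro card_image) (auto simp: inj_on_def relabel_def)

lemma fold_add_demand_sum_relabel: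
  "fold (add_demand_sum a d j) (map (image (relabel a)) Qs) (relabel_state a st)
     = relabel_state a (fold (add_demand_sum unpermuted d j) Qs st)"
proof (induction Qs arbitrary: st)
  case (Cons Q Qs)
  have "add_demand_sum a d j (relabel a ` Q) (relabel_state a st)
      = relabel_state a (add_demand_sum unpermuted d j Q st)"
    by (auto simp: add_demand_sum_def relabel_state_def relabel_def Let_def)
  then show ?case using Cons.IH by simp
qed simp

lemma funpow_add_fresh_sum_relabel:
  "(add_fresh_sum a j K ^^ n) (relabel_state a st)
     = relabel_state a ((add_fresh_sum unpermuted j K ^^ n) st)"
proof (induction n)
  case (Suc n)
  have "add_fresh_sum a j K (relabel_state a st) = relabel_state a (add_fresh_sum unpermuted j K st)"
    for st
    by (auto simp: add_fresh_sum_def relabel_state_def relabel_def Let_def image_image)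
  then show ?case using Suc by simp
qed simp

lemma fold_add_fresh_sum_relabel:
  "fold (\<lambda>K. add_fresh_sum a j K ^^ n) Ks (relabel_state a st)
     = relabel_state a (fold (\<lambda>K. add_fresh_sum unpermuted j K ^^ n) Ks st)"
  by (induction Ks arbitrary: st) (simp_all add: funpow_add_fresh_sum_relabel)

text \<open>The selection looks only at the files of a query and at its size. Renaming preserves the
  files, and the size as well because they are distinct.\<close>

lemma side_information_relabel:
  assumes "run_inv S' N d' st"
  shows "side_information S d k j (relabel_state a st)
       = map (image (relabel a)) (side_information S d k j st)"
proof -
  have "filter (\<lambda>Q. card Q = k - 1 \<and> d \<notin> fst ` Q) (map (image (relabel a)) (collection st i))
      = map (image (relabel a)) (filter (\<lambda>Q. card Q = k - 1 \<and> d \<notin> fst ` Q) (collection st i))" for i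
    unfolding filter_map o_def fst_relabel
    using run_invD(1)[OF assms]
    by (intro arg_cong[where f = "map _"] filter_cong) (auto simp: card_relabel wf_query_def)
  then show ?thesis
    unfolding side_information_eq by (simp add: relabel_state_def map_concat o_def)
qed

lemma process_database_relabel:
  assumes "run_inv S N d st"
  shows "process_database S N a d k j (relabel_state a st)
       = relabel_state a (process_database S N unpermuted d k j st)"
  unfolding process_database_def Let_def side_information_relabel[OF assms]
  by (simp add: fold_add_demand_sum_relabel fold_add_fresh_sum_relabel)

lemma process_round_relabel:
  assumes S: "S \<ge> 2" "k \<ge> 2" "d \<in> {1..N}" "run_inv S N d st" "type_counts S N (\<lambda>_. k) st"
  shows "process_round S N a d k (relabel_state a st)
       = relabel_state a (process_round S N unpermuted d k st)"
proof -
  have "fold (process_database S N a d k) [1..<m] (relabel_state a st)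
      = relabel_state a (fold (process_database S N unpermuted d k) [1..<m] st)"
    if "1 \<le> m" "m \<le> Suc S" for m
    using that
  proof (induction m rule: dec_induct)
    case (step m)
    then have "run_inv S N d (fold (process_database S N unpermuted d k) [1..<m] st)"
      using partial_round_inv[OF assms, of m] by simp
    from process_database_relabel[OF this] show ?case using step by simp
  qed simp
  then show ?thesis unfolding process_round_def by (rule) simp_all
qed

text \<open>Renaming leaves the counters unchanged, so the loop test has the same outcome for every
  \<open>a\<close>: it holds for \<open>k \<le> N\<close> and fails at
  \<open>k = N + 1\<close>.\<close>

lemma generate_queries_eq:
  assumes S: "S \<ge> 2" and N: "N \<ge> 1" and d: "d \<in> {1..N}"
  shows "generate_queries S N d a = relabel_state a (final_state S N d)"
proof -
  let ?R = "\<lambda>k. fold (process_round S N unpermuted d) [2..<k] (initial_state N unpermuted)"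
  let ?P = "\<lambda>(st, k). st = relabel_state a (?R k) \<and> 2 \<le> k \<and> k \<le> Suc N"
  have counter: "counter (relabel_state a st) = counter st" for st
    by (simp add: relabel_state_def)
  have less: "counter (?R k) d < S ^ (N - 1) \<longleftrightarrow> k \<le> N" if "2 \<le> k" "k \<le> Suc N" for k
  proof (cases "k \<le> N")
    case True
    then show ?thesis using counter_demand_less[OF S _ _ d] rounds_inv[OF S d that(1)] by blast
  next
    case False
    then have "k = Suc N" using that by simp
    then show ?thesis using counter_demand_eq[OF S _ _ d] rounds_inv[OF S d that(1)] by simp
  qed
  have "fst (while (\<lambda>(st, k). counter st d < S ^ (N - 1))
      (\<lambda>(st, k). (process_round S N a d k st, k + 1)) (initial_state N a, 2))
      = relabel_state a (?R (Suc N))"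
  proof (rule while_rule[where P = ?P and r = "Wellfounded.measure (\<lambda>(st, k). Suc N - k)"])
    show "?P (initial_state N a, 2)"
      using N by (auto simp: relabel_state_def initial_state_def relabel_def o_def)
  next
    fix s assume P: "?P s" and cond: "case s of (st, k) \<Rightarrow> counter st d < S ^ (N - 1)"
    obtain st k where s: "s = (st, k)" by (cases s)
    have k: "2 \<le> k" "k \<le> Suc N" and st: "st = relabel_state a (?R k)" using P s by auto
    have kN: "k \<le> N" using cond less[OF k] by (simp add: s st counter)
    have "process_round S N a d k st = relabel_state a (?R (Suc k))"
      using process_round_relabel[OF S k(1) d, of "?R k" a] rounds_inv[OF S d k(1)] k(1)
      by (simp add: st)
    then show "?P (case s of (st, k) \<Rightarrow> (process_round S N a d k st, k + 1))"
      using k(1) kN by (simp add: s)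
    show "((case s of (st, k) \<Rightarrow> (process_round S N a d k st, k + 1)), s)
        \<in> Wellfounded.measure (\<lambda>(st, k). Suc N - k)"
      using kN by (simp add: s)
  next
    fix s assume P: "?P s" and cond: "\<not> (case s of (st, k) \<Rightarrow> counter st d < S ^ (N - 1))"
    obtain st k where s: "s = (st, k)" by (cases s)
    have k: "2 \<le> k" "k \<le> Suc N" and st: "st = relabel_state a (?R k)" using P s by auto
    have "\<not> k \<le> N" using cond less[OF k] by (simp add: s st counter)
    with k have "k = Suc N" by simp
    then show "fst s = relabel_state a (?R (Suc N))" by (simp add: s st)
  qed simp
  then show ?thesis by (simp add: generate_queries_def final_state_def)
qed

lemma query_set_eq:
  assumes "S \<ge> 2" "N \<ge> 1" "d \<in> {1..N}"
  shows "query_set S N d a j = image (relabel a) ` set (collection (final_state S N d) j)"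
  by (simp add: query_set_def generate_queries_eq[OF assms] relabel_state_def)

section \<open>Decoding, download and privacy\<close>

lemma bit_add_cancel: "(x + y) + y = (x :: bit)"
  by (cases x; cases y) simp_all

lemma length_subfile:
  assumes "n * b = L" "W \<in> file_systems N L" "d \<in> {1..N}" "m \<in> {1..n}"
  shows "length (subfile b W d m) = b"
proof -
  have "length (W d) = L" using assms(2,3) by (auto simp: file_systems_def PiE_iff)
  moreover have "(m - 1) * b + b \<le> L"
  proof -
    have "(m - 1) * b + b = m * b" using assms(4) by (cases m) auto
    also have "\<dots> \<le> n * b" using assms(4) by (intro mult_right_mono) auto
    finally show ?thesis using assms(1) by simp
  qed
  ultimately show ?thesis by (simp add: subfile_def)
qed

lemma sum_answer_singleton:
  "length (subfile b W d m) = b \<Longrightarrow> sum_answer b W {(d, m)} = subfile b W d m"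
  by (auto simp: sum_answer_def intro: nth_equalityI)

text \<open>In characteristic two, adding the side information once more cancels it.\<close>

lemma subfile_eq_answer_plus_side_information:
  assumes "length (subfile b W d m) = b" "finite Q" "(d, m) \<notin> Q"
  shows "subfile b W d m = map2 (+) (sum_answer b W (insert (d, m) Q)) (sum_answer b W Q)"
  using assms
  by (intro nth_equalityI) (auto simp: sum_answer_def bit_add_cancel)

lemma file_eq_if_subfiles_eq:
  assumes n: "n * b = L" and W: "W \<in> file_systems N L" "W' \<in> file_systems N L" "d \<in> {1..N}"
    and eq: "\<And>m. m \<in> {1..n} \<Longrightarrow> subfile b W d m = subfile b W' d m"
  shows "W d = W' d"
proof (rule nth_equalityI)
  have len: "length (W d) = L" "length (W' d) = L"
    using W by (auto simp: file_systems_def PiE_iff)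
  then show "length (W d) = length (W' d)" by simp
  fix p assume "p < length (W d)"
  then have p: "p < n * b" using len n by simp
  then have b: "b > 0" by (cases b) auto
  \<comment> \<open>Bit \<open>p\<close> lies at offset \<open>p mod b\<close> of its subfile; the
    successor appears because subfiles are numbered from 1.\<close>
  have nth: "subfile b V d (Suc (p div b)) ! (p mod b) = V d ! p" if "length (V d) = L" for V
  proof -
    have "p div b * b \<le> length (V d)" using that p n by (simp add: le_trans[OF div_times_less_eq_dividend])
    then have "drop (p div b * b) (V d) ! (p mod b) = V d ! (p div b * b + p mod b)"
      by (rule nth_drop)
    then show ?thesis using b by (simp add: subfile_def)
  qed
  have "Suc (p div b) \<in> {1..n}"
    using p b by (simp add: less_mult_imp_div_less Suc_le_eq)
  from eq[OF this] nth[of W, OF len(1)] nth[of W', OF len(2)] show "W d ! p = W' d ! p" by simp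
qed

lemma query_set_decodable:
  assumes S: "S \<ge> 2" "N \<ge> 1" "d \<in> {1..N}" and a: "a d permutes {1..S ^ (N - 1)}"
    and m: "m \<in> {1..S ^ (N - 1)}"
  shows "(\<exists>j\<in>{1..S}. {(d, m)} \<in> query_set S N d a j) \<or>
     (\<exists>i\<in>{1..S}. \<exists>j\<in>{1..S}. \<exists>Q\<in>query_set S N d a i.
        finite Q \<and> (d, m) \<notin> Q \<and> insert (d, m) Q \<in> query_set S N d a j)"
proof -
  note inv = final_state_inv[OF S(1,3)]
  \<comment> \<open>The invariant speaks of indices in the run; subfile \<open>m\<close> of the
    demand is the one used at index \<open>t\<close>.\<close>
  obtain t where t: "t \<in> {1..S ^ (N - 1)}" "a d t = m"
    using m permutes_image[OF a] by (metis imageE)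
  have "decodable S d (collection (final_state S N d)) t"
    using run_invD(5)[OF inv(1)] t(1) counter_demand_eq[OF S(1) inv S(3)] by simp
  then show ?thesis unfolding decodable_def
  proof (elim disjE bexE conjE)
    fix j assume j: "j \<in> {1..S}" "{(d, t)} \<in> set (collection (final_state S N d) j)"
    then have "relabel a ` {(d, t)} \<in> query_set S N d a j"
      unfolding query_set_eq[OF S] by blast
    then have "{(d, m)} \<in> query_set S N d a j" by (simp add: relabel_def t(2))
    then show ?thesis using j(1) by blast
  next
    fix i j Q assume ij: "i \<in> {1..S}" "j \<in> {1..S}"
      and Q: "Q \<in> set (collection (final_state S N d) i)" "d \<notin> fst ` Q"
        "insert (d, t) Q \<in> set (collection (final_state S N d) j)"
    have "relabel a ` Q \<in> query_set S N d a i" "relabel a ` insert (d, t) Q \<in> query_set S N d a j"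
      using Q unfolding query_set_eq[OF S] by blast+
    moreover have "relabel a ` insert (d, t) Q = insert (d, m) (relabel a ` Q)"
      by (simp add: relabel_def t(2))
    moreover have "finite (relabel a ` Q)"
      using run_invD(1)[OF inv(1) Q(1)] by (simp add: wf_query_def)
    moreover have "(d, m) \<notin> relabel a ` Q" using Q(2) by (force simp: relabel_def)
    ultimately show ?thesis using ij by metis
  qed
qed

lemma subfile_decodable:
  assumes S: "S \<ge> 2" "N \<ge> 1" "d \<in> {1..N}" and a: "a d permutes {1..S ^ (N - 1)}"
    and L: "S ^ (N - 1) * b = L" and m: "m \<in> {1..S ^ (N - 1)}"
  shows "\<exists>dec. \<forall>W\<in>file_systems N L.
    dec (\<lambda>j\<in>{1..S}. \<lambda>Q\<in>query_set S N d a j. sum_answer b W Q) = subfile b W d m"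
proof -
  note len = length_subfile[OF L _ S(3) m]
  from query_set_decodable[where a = a, OF assms(1-4) m] show ?thesis
  proof (elim disjE bexE conjE)
    fix j assume j: "j \<in> {1..S}" "{(d, m)} \<in> query_set S N d a j"
    show ?thesis
      by (rule exI[of _ "\<lambda>ans. ans j {(d, m)}"]) (use j in \<open>simp add: sum_answer_singleton len\<close>)
  next
    fix i j Q assume ij: "i \<in> {1..S}" "j \<in> {1..S}" and Q: "Q \<in> query_set S N d a i"
      "finite Q" "(d, m) \<notin> Q" "insert (d, m) Q \<in> query_set S N d a j"
    show ?thesis
      by (rule exI[of _ "\<lambda>ans. map2 (+) (ans j (insert (d, m) Q)) (ans i Q)"])
         (use ij Q in \<open>simp add: subfile_eq_answer_plus_side_information[OF len Q(2,3)]\<close>)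
  qed
qed

lemma correctness:
  assumes S: "S \<ge> 2" "N \<ge> 1" "d \<in> {1..N}" and a: "a d permutes {1..S ^ (N - 1)}"
    and L: "S ^ (N - 1) * b = L"
  shows "\<exists>dec. \<forall>W\<in>file_systems N L. \<forall>m\<in>{1..S ^ (N - 1)}.
    dec (\<lambda>j\<in>{1..S}. \<lambda>Q\<in>query_set S N d a j. sum_answer b W Q) m = subfile b W d m"
proof -
  have "\<forall>m\<in>{1..S ^ (N - 1)}. \<exists>dec. \<forall>W\<in>file_systems N L.
      dec (\<lambda>j\<in>{1..S}. \<lambda>Q\<in>query_set S N d a j. sum_answer b W Q) = subfile b W d m"
    using subfile_decodable[where a = a, OF assms] by blast
  from bchoice[OF this] obtain dec where "\<forall>m\<in>{1..S ^ (N - 1)}. \<forall>W\<in>file_systems N L.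
      dec m (\<lambda>j\<in>{1..S}. \<lambda>Q\<in>query_set S N d a j. sum_answer b W Q) = subfile b W d m" ..
  then show ?thesis by (intro exI[of _ "\<lambda>ans m. dec m ans"]) blast
qed

section \<open>Size of the download\<close>

lemma distinct_collection:
  assumes "run_inv S N d st"
  shows "distinct (collection st j)"
proof -
  have "distinct xs" if "sorted_wrt (\<lambda>Q Q'. Q \<inter> Q' = {}) xs" "\<And>Q. Q \<in> set xs \<Longrightarrow> Q \<noteq> {}"
    for xs :: "sum_query list"
    using that by (induction xs) auto
  then show ?thesis
    using run_invD(1,2)[OF assms] unfolding wf_query_def by blast
qed

text \<open>A database receives a set, so a renaming could merge sums. Permutations act injectively
  on all subfiles that occur, which excludes this.\<close>

lemma card_query_set:
  assumes S: "S \<ge> 2" "N \<ge> 1" "d \<in> {1..N}"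
    and a: "\<And>i. i \<in> {1..N} \<Longrightarrow> a i permutes {1..S ^ (N - 1)}"
  shows "card (query_set S N d a j) = length (collection (final_state S N d) j)"
proof -
  note inv = final_state_inv(1)[OF S(1,3)]
  let ?Qs = "set (collection (final_state S N d) j)"
  have "inj_on (relabel a) (\<Union>?Qs)"
  proof (rule inj_onI)
    fix p q assume "p \<in> \<Union>?Qs" "q \<in> \<Union>?Qs" and eq: "relabel a p = relabel a q"
    then have "fst p \<in> {1..N}" using run_invD(1)[OF inv] unfolding wf_query_def by blast
    from permutes_inj[OF a[OF this]] have "inj (a (fst p))" .
    moreover have "fst p = fst q" "a (fst p) (snd p) = a (fst p) (snd q)"
      using eq by (auto simp: relabel_def)
    ultimately show "p = q" by (simp add: prod_eq_iff inj_eq)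
  qed
  then have "inj_on (image (relabel a)) ?Qs" by (rule inj_on_image)
  then have "card (query_set S N d a j) = card ?Qs"
    unfolding query_set_eq[OF S] by (rule card_image)
  also have "\<dots> = length (collection (final_state S N d) j)"
    by (rule distinct_card[OF distinct_collection[OF inv]])
  finally show ?thesis .
qed

lemma total_download:
  assumes S: "S \<ge> 2" "N \<ge> 1" "d \<in> {1..N}"
    and a: "\<And>i. i \<in> {1..N} \<Longrightarrow> a i permutes {1..S ^ (N - 1)}"
    and L: "S ^ (N - 1) * b = L"
  shows "real (\<Sum>j=1..S. card (query_set S N d a j) * b) = real L * (\<Sum>i<N. 1 / real S ^ i)"
proof -
  have "real (\<Sum>j=1..S. card (query_set S N d a j) * b)
      = real b * real (\<Sum>j=1..S. length (collection (final_state S N d) j))"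
    using card_query_set[where a = a, OF S a] by (simp add: sum_distrib_left mult.commute)
  also have "\<dots> = real (S ^ (N - 1) * b) * (\<Sum>i<N. 1 / real S ^ i)"
    unfolding final_total[OF S(1,3)] by simp
  finally show ?thesis by (simp only: L)
qed

section \<open>Privacy by renaming subfiles\<close>

text \<open>Sending \<open>f x\<close> to \<open>g x\<close> is a bijection between equally large
  subsets of \<open>U\<close>; their complements are equally large too, so any bijection between
  them completes it.\<close>

lemma extend_to_permutation:
  assumes U: "finite U" and f: "inj_on f X" "f ` X \<subseteq> U" and g: "inj_on g X" "g ` X \<subseteq> U"
  shows "\<exists>p. p permutes U \<and> (\<forall>x\<in>X. p (f x) = g x)"
proof -
  have "card (f ` X) = card (g ` X)" using f(1) g(1) by (simp add: card_image)
  then have "card (U - f ` X) = card (U - g ` X)"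
    using U f(2) g(2) by (simp add: card_Diff_subset finite_subset)
  then obtain h where h: "bij_betw h (U - f ` X) (U - g ` X)"
    using U by (metis finite_Diff finite_same_card_bij)
  define p where "p m = (if m \<in> f ` X then g (inv_into X f m) else if m \<in> U then h m else m)" for m
  have p: "p (f x) = g x" if "x \<in> X" for x using that f(1) by (simp add: p_def)
  have "bij_betw p (f ` X) (g ` X)"
    using p f(1) g(1) by (auto simp: bij_betw_def inj_on_def image_image)
  moreover have "bij_betw p (U - f ` X) (U - g ` X)"
    using h by (rule bij_betw_cong[THEN iffD1, rotated]) (simp add: p_def)
  ultimately have "bij_betw p (f ` X \<union> (U - f ` X)) (g ` X \<union> (U - g ` X))"
    by (rule bij_betw_combine) auto
  then have "bij_betw p U U" using f(2) g(2) by (simp add: Un_absorb1)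
  then have "p permutes U" by (rule bij_imp_permutes) (use f(2) in \<open>auto simp: p_def\<close>)
  with p show ?thesis by blast
qed

definition index_of :: "nat \<Rightarrow> sum_query \<Rightarrow> nat" where
  "index_of i Q = (THE m. (i, m) \<in> Q)"

lemma index_of_eq:
  assumes "inj_on fst Q" "(i, m) \<in> Q"
  shows "index_of i Q = m"
  unfolding index_of_def
proof (rule the_equality)
  fix m' assume "(i, m') \<in> Q"
  with inj_onD[OF assms(1) _ assms(2), of "(i, m')"] show "m' = m" by simp
qed fact

lemma index_of_mem:
  assumes "inj_on fst Q" "i \<in> fst ` Q"
  shows "(i, index_of i Q) \<in> Q"
  using assms index_of_eq[OF assms(1)] by auto

text \<open>
  Up to renaming the subfiles of each file, a family of disjoint queries is determined by how
  many queries it has of each type.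
\<close>

lemma ex_relabelling:
  fixes T T' :: "sum_query set"
  assumes fin: "finite T" "finite T'"
    and wf: "\<And>Q. Q \<in> T \<Longrightarrow> wf_query N (\<lambda>_. n) Q" "\<And>Q. Q \<in> T' \<Longrightarrow> wf_query N (\<lambda>_. n) Q"
    and disj: "\<And>A B. A \<in> T \<Longrightarrow> B \<in> T \<Longrightarrow> A = B \<or> A \<inter> B = {}"
      "\<And>A B. A \<in> T' \<Longrightarrow> B \<in> T' \<Longrightarrow> A = B \<or> A \<inter> B = {}"
    and card: "\<And>K. card {Q\<in>T. fst ` Q = K} = card {Q\<in>T'. fst ` Q = K}"
  shows "\<exists>\<pi>. (\<forall>i\<in>{1..N}. \<pi> i permutes {1..n}) \<and> (\<forall>i. i \<notin> {1..N} \<longrightarrow> \<pi> i = id)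
           \<and> T' = image (relabel \<pi>) ` T"
proof -
  have "\<exists>b. bij_betw b {Q\<in>T. fst ` Q = K} {Q\<in>T'. fst ` Q = K}" for K
    using fin by (intro finite_same_card_bij card) auto
  then have "\<forall>K. \<exists>b. bij_betw b {Q\<in>T. fst ` Q = K} {Q\<in>T'. fst ` Q = K}" by blast
  from choice[OF this] obtain b
    where b: "\<And>K. bij_betw (b K) {Q\<in>T. fst ` Q = K} {Q\<in>T'. fst ` Q = K}" by blast
  \<comment> \<open>Bijections chosen separately for each type are glued to one type-preserving
    bijection from \<open>T\<close> to \<open>T'\<close>.\<close>
  define \<beta> where "\<beta> Q = b (fst ` Q) Q" for Q
  have \<beta>: "\<beta> Q \<in> T' \<and> fst ` \<beta> Q = fst ` Q" if "Q \<in> T" for Q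
    using bij_betwE[OF b[of "fst ` Q"]] that unfolding \<beta>_def by blast
  have inj: "inj_on \<beta> T"
  proof (rule inj_onI)
    fix A B assume AB: "A \<in> T" "B \<in> T" "\<beta> A = \<beta> B"
    then have "fst ` A = fst ` B" using \<beta>[OF AB(1)] \<beta>[OF AB(2)] by simp
    with AB bij_betw_imp_inj_on[OF b[of "fst ` A"]] show "A = B"
      unfolding \<beta>_def inj_on_def by auto
  qed
  have surj: "T' = \<beta> ` T"
  proof (intro equalityI subsetI)
    fix Q' assume Q': "Q' \<in> T'"
    then have "Q' \<in> b (fst ` Q') ` {Q\<in>T. fst ` Q = fst ` Q'}"
      using bij_betw_imp_surj_on[OF b[of "fst ` Q'"]] by blast
    then obtain Q where "Q \<in> T" "fst ` Q = fst ` Q'" "Q' = b (fst ` Q') Q" by blast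
    then show "Q' \<in> \<beta> ` T" by (intro image_eqI[of _ _ Q]) (simp_all add: \<beta>_def)
  qed (use \<beta> in auto)
  have inj_fst: "inj_on fst Q" if "Q \<in> T \<or> Q \<in> T'" for Q
    using that wf(1)[of Q] wf(2)[of Q] unfolding wf_query_def by blast
  let ?X = "\<lambda>i. {Q\<in>T. i \<in> fst ` Q}"
  \<comment> \<open>Disjoint queries containing file \<open>i\<close> use different indices of it,
    in \<open>T\<close> and in \<open>T'\<close>. Hence matching the index in \<open>Q\<close> with
    that in \<open>\<beta> Q\<close> is a partial injection.\<close>
  have "\<exists>p. p permutes {1..n} \<and> (\<forall>Q\<in>?X i. p (index_of i Q) = index_of i (\<beta> Q))" for i
  proof (rule extend_to_permutation)
    have eq: "A = B" if "A \<in> C" "B \<in> C" "C = T \<or> C = T'" "i \<in> fst ` A" "i \<in> fst ` B"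
      "index_of i A = index_of i B" for A B C
    proof -
      have "inj_on fst A" "inj_on fst B" using that(1-3) inj_fst by blast+
      then have "(i, index_of i A) \<in> A \<inter> B"
        using index_of_mem[of A i] index_of_mem[of B i] that(4-6) by simp
      then show ?thesis using that(1-3) disj by blast
    qed
    have range: "index_of i Q \<in> {1..n}" if Q: "Q \<in> T \<or> Q \<in> T'" "i \<in> fst ` Q" for Q
    proof -
      have "(i, index_of i Q) \<in> Q" using index_of_mem[OF inj_fst] Q by blast
      moreover have "wf_query N (\<lambda>_. n) Q" using Q(1) wf by blast
      ultimately show ?thesis unfolding wf_query_def by fastforce
    qed
    show "inj_on (index_of i) (?X i)"
      by (rule inj_onI) (rule eq[where C = T], auto)
    show "index_of i ` ?X i \<subseteq> {1..n}" using range by blast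
    show "inj_on (\<lambda>Q. index_of i (\<beta> Q)) (?X i)"
    proof (rule inj_onI)
      fix A B assume AB: "A \<in> ?X i" "B \<in> ?X i" "index_of i (\<beta> A) = index_of i (\<beta> B)"
      then have "\<beta> A = \<beta> B" using \<beta> by (intro eq[where C = T']) auto
      then show "A = B" using inj AB by (auto dest: inj_onD)
    qed
    show "(\<lambda>Q. index_of i (\<beta> Q)) ` ?X i \<subseteq> {1..n}"
      using range \<beta> by (intro image_subsetI) auto
  qed simp
  then have "\<forall>i. \<exists>p. p permutes {1..n} \<and> (\<forall>Q\<in>?X i. p (index_of i Q) = index_of i (\<beta> Q))"
    by blast
  from choice[OF this] obtain p where p: "\<And>i. p i permutes {1..n}"
    "\<And>i Q. Q \<in> T \<Longrightarrow> i \<in> fst ` Q \<Longrightarrow> p i (index_of i Q) = index_of i (\<beta> Q)"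
    by blast
  \<comment> \<open>The identity outside \<open>{1..N}\<close> agrees with the default value of
    \<open>random_permutations\<close>, so composition with \<open>\<pi>\<close> stays in the sample
    space.\<close>
  define \<pi> where "\<pi> i = (if i \<in> {1..N} then p i else id)" for i
  have "relabel \<pi> ` Q = \<beta> Q" if Q: "Q \<in> T" for Q
  proof -
    have rel: "relabel \<pi> (i, m) = (i, index_of i (\<beta> Q))" if im: "(i, m) \<in> Q" for i m
    proof -
      have i: "i \<in> fst ` Q" using im by force
      then have "i \<in> {1..N}" using wf(1)[OF Q] by (auto simp: wf_query_def)
      then show ?thesis
        using p(2)[OF Q i] index_of_eq[OF inj_fst im] Q by (simp add: relabel_def \<pi>_def)
    qed
    have inj\<beta>: "inj_on fst (\<beta> Q)" using inj_fst \<beta>[OF Q] by blast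
    show ?thesis
    proof (intro equalityI subsetI)
      fix x assume "x \<in> relabel \<pi> ` Q"
      then obtain i m where "(i, m) \<in> Q" "x = (i, index_of i (\<beta> Q))" using rel by auto
      moreover from this have "i \<in> fst ` \<beta> Q" using \<beta>[OF Q] by force
      ultimately show "x \<in> \<beta> Q" using index_of_mem[OF inj\<beta>] by simp
    next
      fix x assume x: "x \<in> \<beta> Q"
      then have "fst x \<in> fst ` Q" using \<beta>[OF Q] by blast
      then obtain m where im: "(fst x, m) \<in> Q" by auto
      have "index_of (fst x) (\<beta> Q) = snd x" using index_of_eq[OF inj\<beta>, of "fst x" "snd x"] x by simp
      then have "relabel \<pi> (fst x, m) = x" using rel[OF im] by simp
      then show "x \<in> relabel \<pi> ` Q" using im by force
    qed
  qed
  then have "T' = image (relabel \<pi>) ` T" unfolding surj by (intro image_cong) auto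
  moreover have "\<forall>i\<in>{1..N}. \<pi> i permutes {1..n}" "\<forall>i. i \<notin> {1..N} \<longrightarrow> \<pi> i = id"
    using p(1) by (auto simp: \<pi>_def)
  ultimately show ?thesis by blast
qed

text \<open>\<open>\<pi>\<close> is built from the runs with identity indices and therefore serves
  all \<open>a\<close> at once. It may depend on \<open>j\<close>, and so the argument protects only
  against individual databases.\<close>

lemma ex_permutations_exchanging_demands:
  assumes S: "S \<ge> 2" "N \<ge> 1" and d: "d \<in> {1..N}" "d' \<in> {1..N}" and j: "j \<in> {1..S}"
  shows "\<exists>\<pi>. (\<forall>i\<in>{1..N}. \<pi> i permutes {1..S ^ (N - 1)}) \<and> (\<forall>i. i \<notin> {1..N} \<longrightarrow> \<pi> i = id) \<and>
           (\<forall>a. query_set S N d' a j = query_set S N d (\<lambda>i. a i \<circ> \<pi> i) j)"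
proof -
  let ?T = "\<lambda>d. set (collection (final_state S N d) j)"
  have wf: "wf_query N (\<lambda>_. S ^ (N - 1)) Q" if d: "d \<in> {1..N}" and Q: "Q \<in> ?T d" for d Q
  proof -
    note inv = final_state_inv[OF S(1) d]
    have "wf_query N (counter (final_state S N d)) Q" using run_invD(1)[OF inv(1) Q] .
    then show ?thesis
      using counter_le[OF S(1) inv] unfolding wf_query_def
      by (meson image_eqI order_trans subsetD)
  qed
  have disj: "A = B \<or> A \<inter> B = {}" if d: "d \<in> {1..N}" and "A \<in> ?T d" "B \<in> ?T d" for d A B
    using sorted_wrt_disjoint_cases[OF run_invD(2)[OF final_state_inv(1)[OF S(1) d]]] that by blast
  have card: "card {Q \<in> ?T d. fst ` Q = K}
      = (if K \<noteq> {} \<and> K \<subseteq> {1..N} then phi j S (card K) else 0)" if d: "d \<in> {1..N}" for d K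
  proof (cases "K \<noteq> {} \<and> K \<subseteq> {1..N}")
    case True
    note inv = final_state_inv[OF S(1) d]
    have "card {Q \<in> ?T d. fst ` Q = K} = length (filter (\<lambda>Q. fst ` Q = K) (collection (final_state S N d) j))"
      using distinct_length_filter[OF distinct_collection[OF inv(1)], of "\<lambda>Q. fst ` Q = K" j]
      by (simp add: Int_def conj_commute)
    also have "\<dots> = count_list (types (final_state S N d) j) K"
      by (simp add: types_def count_list_map)
    also have "\<dots> = phi j S (card K)"
      using type_countsD[OF inv(2) j, of K] True card_mono[of "{1..N}" K] by auto
    finally show ?thesis using True by simp
  next
    case False
    then have "{Q \<in> ?T d. fst ` Q = K} = {}" using wf[OF d] by (auto simp: wf_query_def)
    then show ?thesis using False by (simp only: if_False card.empty)
  qed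
  obtain \<pi> where \<pi>: "\<forall>i\<in>{1..N}. \<pi> i permutes {1..S ^ (N - 1)}" "\<forall>i. i \<notin> {1..N} \<longrightarrow> \<pi> i = id"
    "?T d' = image (relabel \<pi>) ` ?T d"
    using ex_relabelling[of "?T d" "?T d'" N "S ^ (N - 1)", OF _ _ wf[OF d(1)] wf[OF d(2)]
        disj[OF d(1)] disj[OF d(2)]] card[OF d(1)] card[OF d(2)] by auto
  have "query_set S N d' a j = query_set S N d (\<lambda>i. a i \<circ> \<pi> i) j" for a
    unfolding query_set_eq[OF S d(1)] query_set_eq[OF S d(2)] \<pi>(3)
    by (simp add: image_image relabel_def)
  with \<pi>(1,2) show ?thesis by blast
qed

lemma random_permutations_eq:
  "random_permutations S N
     = pmf_of_set (PiE_dflt {1..N} id (\<lambda>_. {p. p permutes {1..S ^ (N - 1)}}))"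
  unfolding random_permutations_def
  by (intro Pi_pmf_of_set) (auto simp: finite_permutations intro: permutes_id)

lemma finite_nonempty_permutation_families:
  "finite (PiE_dflt {1..N :: nat} id (\<lambda>_. {p. p permutes {1..n :: nat}}))"
  "PiE_dflt {1..N :: nat} id (\<lambda>_. {p. p permutes {1..n :: nat}}) \<noteq> {}"
proof -
  show "finite (PiE_dflt {1..N :: nat} id (\<lambda>_. {p. p permutes {1..n :: nat}}))"
    by (intro finite_PiE_dflt) (auto simp: finite_permutations)
  have "(\<lambda>_. id) \<in> PiE_dflt {1..N :: nat} id (\<lambda>_. {p. p permutes {1..n :: nat}})"
    by (auto simp: PiE_dflt_def permutes_id)
  then show "PiE_dflt {1..N :: nat} id (\<lambda>_. {p. p permutes {1..n :: nat}}) \<noteq> {}" by blast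
qed

lemma random_permutations_permutes:
  assumes "a \<in> set_pmf (random_permutations S N)" "i \<in> {1..N}"
  shows "a i permutes {1..S ^ (N - 1)}"
  using assms unfolding random_permutations_eq set_pmf_of_set[OF finite_nonempty_permutation_families(2,1)]
  by (auto simp: PiE_dflt_def)

text \<open>Every \<open>\<pi> i\<close> is surjective, so composition with \<open>\<pi>\<close> is
  injective; on a finite sample space it is then a bijection and preserves the uniform
  distribution.\<close>

lemma random_permutations_comp:
  assumes "\<forall>i\<in>{1..N}. \<pi> i permutes {1..S ^ (N - 1)}" "\<forall>i. i \<notin> {1..N} \<longrightarrow> \<pi> i = id"
  shows "map_pmf (\<lambda>a i. a i \<circ> \<pi> i) (random_permutations S N) = random_permutations S N"
proof -
  let ?A = "PiE_dflt {1..N} id (\<lambda>_. {p. p permutes {1..S ^ (N - 1)}})"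
  let ?f = "\<lambda>(a :: nat \<Rightarrow> nat \<Rightarrow> nat) i. a i \<circ> \<pi> i"
  have surj: "surj (\<pi> i)" for i
  proof (cases "i \<in> {1..N}")
    case True
    with assms(1) show ?thesis using permutes_surj by blast
  next
    case False
    with assms(2) show ?thesis by simp
  qed
  have inj: "inj_on ?f ?A"
  proof (rule inj_onI, rule ext)
    fix a a' i assume "?f a = ?f a'"
    then have "a i \<circ> \<pi> i = a' i \<circ> \<pi> i" by (rule fun_cong)
    then show "a i = a' i" using surj[of i] by (metis surj_fun_eq[of "\<pi> i" UNIV "a i" "a' i"] UNIV_I o_apply ext)
  qed
  moreover have "?f ` ?A \<subseteq> ?A"
    using assms by (auto simp: PiE_dflt_def intro: permutes_compose)
  ultimately have "bij_betw ?f ?A ?A"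
    using endo_inj_surj[OF finite_nonempty_permutation_families(1)] by (simp add: bij_betw_def)
  then show ?thesis
    unfolding random_permutations_eq
    by (rule map_pmf_of_set_bij_betw) (rule finite_nonempty_permutation_families)+
qed

lemma privacy:
  assumes "S \<ge> 2" "N \<ge> 1" "d \<in> {1..N}" "d' \<in> {1..N}" "j \<in> {1..S}"
  shows "map_pmf (\<lambda>a. query_set S N d a j) (random_permutations S N)
       = map_pmf (\<lambda>a. query_set S N d' a j) (random_permutations S N)"
proof -
  obtain \<pi> where \<pi>: "\<forall>i\<in>{1..N}. \<pi> i permutes {1..S ^ (N - 1)}" "\<forall>i. i \<notin> {1..N} \<longrightarrow> \<pi> i = id"
    "\<forall>a. query_set S N d' a j = query_set S N d (\<lambda>i. a i \<circ> \<pi> i) j"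
    using ex_permutations_exchanging_demands[OF assms] by blast
  have "map_pmf (\<lambda>a. query_set S N d' a j) (random_permutations S N)
      = map_pmf (\<lambda>a. query_set S N d a j)
          (map_pmf (\<lambda>a i. a i \<circ> \<pi> i) (random_permutations S N))"
    using \<pi>(3) by (simp add: pmf.map_comp o_def)
  then show ?thesis using random_permutations_comp[OF \<pi>(1,2)] by simp
qed

section \<open>The algorithm as a PIR scheme\<close>

lemma set_listing:
  assumes "finite A"
  shows "set (set_listing A) = A \<and> distinct (set_listing A)"
  unfolding set_listing_def by (rule someI_ex) (rule finite_distinct_list[OF assms])

lemma finite_query_set: "finite (query_set S N d a j)"
  by (simp add: query_set_def)

lemma length_sum_answer: "length (sum_answer b W Q) = b"
  by (simp add: sum_answer_def)

lemma length_algorithm_answer: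
  "length (scheme_answer (algorithm_scheme S N L) j (query_set S N d a j) W)
     = card (query_set S N d a j) * (L div S ^ (N - 1))"
proof -
  have "length (set_listing (query_set S N d a j)) = card (query_set S N d a j)"
    using set_listing[OF finite_query_set] distinct_card by metis
  then show ?thesis
    by (simp add: algorithm_scheme_def length_concat o_def length_sum_answer sum_list_triv)
qed

lemma algorithm_scheme_correct:
  assumes S: "S \<ge> 2" "N \<ge> 1" and L: "S ^ (N - 1) dvd L"
  shows "pir_correct S N L (algorithm_scheme S N L)"
  unfolding pir_correct_def
proof (intro ballI)
  let ?b = "L div S ^ (N - 1)"
  let ?P = "algorithm_scheme S N L"
  fix d a assume d: "d \<in> {1..N}" and "a \<in> set_pmf (scheme_rand ?P)"
  then have a: "a d permutes {1..S ^ (N - 1)}"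
    using random_permutations_permutes by (simp add: algorithm_scheme_def)
  have Lb: "S ^ (N - 1) * ?b = L" using L by simp
  from correctness[where a = a, OF S d a Lb] obtain dec
    where dec: "\<forall>W\<in>file_systems N L. \<forall>m\<in>{1..S ^ (N - 1)}.
      dec (\<lambda>j\<in>{1..S}. \<lambda>Q\<in>query_set S N d a j. sum_answer ?b W Q) m = subfile ?b W d m" ..
  let ?ans = "\<lambda>W. \<lambda>j\<in>{1..S}. scheme_answer ?P j (scheme_query ?P d a j) W"
  have det: "W d = W' d"
    if W: "W \<in> file_systems N L" "W' \<in> file_systems N L" and eq: "?ans W = ?ans W'" for W W'
  proof (rule file_eq_if_subfiles_eq[OF Lb W d])
    have "sum_answer ?b W Q = sum_answer ?b W' Q" if j: "j \<in> {1..S}" and Q: "Q \<in> query_set S N d a j" for j Q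
    proof -
      let ?xs = "set_listing (query_set S N d a j)"
      \<comment> \<open>All sums have answers of the same length and the listing depends only on the
        query set, so the concatenation splits in a unique way.\<close>
      have "concat (map (sum_answer ?b W) ?xs) = concat (map (sum_answer ?b W') ?xs)"
        using fun_cong[OF eq, of j] j by (simp add: algorithm_scheme_def)
      then have "map (sum_answer ?b W) ?xs = map (sum_answer ?b W') ?xs"
        by (rule concat_injective) (auto simp: zip_map_map length_sum_answer)
      then show ?thesis using Q set_listing[OF finite_query_set[of S N d a j]] by (metis map_eq_conv)
    qed
    then have "(\<lambda>j\<in>{1..S}. \<lambda>Q\<in>query_set S N d a j. sum_answer ?b W Q)
        = (\<lambda>j\<in>{1..S}. \<lambda>Q\<in>query_set S N d a j. sum_answer ?b W' Q)"
      by (intro restrict_ext) auto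
    then show "subfile ?b W d m = subfile ?b W' d m" if "m \<in> {1..S ^ (N - 1)}" for m
      using bspec[OF bspec[OF dec W(1)] that] bspec[OF bspec[OF dec W(2)] that] by simp
  qed
  \<comment> \<open>The decoder picks any file system consistent with the answers; by
    \<open>det\<close> its file \<open>d\<close> is the right one.\<close>
  have "W d = (SOME W'. W' \<in> file_systems N L \<and> ?ans W' = ?ans W) d" if W: "W \<in> file_systems N L" for W
  proof -
    have "\<exists>W'. W' \<in> file_systems N L \<and> ?ans W' = ?ans W" using W by blast
    from someI_ex[OF this] have "(SOME W'. W' \<in> file_systems N L \<and> ?ans W' = ?ans W) \<in> file_systems N L"
      "?ans W = ?ans (SOME W'. W' \<in> file_systems N L \<and> ?ans W' = ?ans W)" by simp_all
    then show ?thesis by (rule det[OF W])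
  qed
  then show "\<exists>dec. \<forall>W\<in>file_systems N L. dec (?ans W) = W d"
    by (intro exI[of _ "\<lambda>y. (SOME W'. W' \<in> file_systems N L \<and> ?ans W' = y) d"]) simp
qed

lemma algorithm_is_pir_scheme:
  assumes S: "S \<ge> 2" "N \<ge> 1" and L: "S ^ (N - 1) dvd L"
  shows "is_pir_scheme S N L (algorithm_scheme S N L)"
proof -
  have "pir_private S N (algorithm_scheme S N L)"
    unfolding pir_private_def algorithm_scheme_def pir_scheme.simps
    by (intro ballI privacy S)
  moreover have "pir_lengths_by_query S N L (algorithm_scheme S N L)"
    unfolding pir_lengths_by_query_def
    using length_algorithm_answer by (simp add: algorithm_scheme_def)
  ultimately show ?thesis
    using algorithm_scheme_correct[OF assms] by (simp add: is_pir_scheme_def)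
qed

lemma algorithm_pir_rate:
  assumes S: "S \<ge> 2" "N \<ge> 1" and L: "S ^ (N - 1) dvd L" "L > 0" and d: "d \<in> {1..N}"
  shows "pir_rate S L (algorithm_scheme S N L) d W = ennreal (\<Sum>i<N. 1 / real S ^ i)"
proof -
  let ?P = "algorithm_scheme S N L"
  let ?R = "\<Sum>i<N. 1 / real S ^ i"
  have "(\<integral>\<^sup>+ r. of_nat (\<Sum>j=1..S. length (scheme_answer ?P j (scheme_query ?P d r j) W))
      \<partial>measure_pmf (scheme_rand ?P)) = (\<integral>\<^sup>+ r. ennreal (real L * ?R) \<partial>measure_pmf (scheme_rand ?P))"
  proof (rule nn_integral_cong_AE, rule AE_pmfI)
    fix a assume "a \<in> set_pmf (scheme_rand ?P)"
    then have a: "\<And>i. i \<in> {1..N} \<Longrightarrow> a i permutes {1..S ^ (N - 1)}"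
      using random_permutations_permutes by (simp add: algorithm_scheme_def)
    have query: "scheme_query ?P = query_set S N" by (simp add: algorithm_scheme_def)
    have "real (\<Sum>j=1..S. length (scheme_answer ?P j (scheme_query ?P d a j) W)) = real L * ?R"
      unfolding query length_algorithm_answer using L by (intro total_download S d a) auto
    then show "of_nat (\<Sum>j=1..S. length (scheme_answer ?P j (scheme_query ?P d a j) W))
        = ennreal (real L * ?R)"
      by (metis ennreal_of_nat_eq_real_of_nat)
  qed
  also have "\<dots> = ennreal (real L * ?R)" by simp
  finally show ?thesis
    using L(2) by (simp add: pir_rate_def ennreal_of_nat_eq_real_of_nat divide_ennreal sum_nonneg)
qed

theorem mainTheorem1:
  fixes S N L :: nat
  assumes "S \<ge> 2" and "N \<ge> 2" and "L > 0" and "S ^ (N - 1) dvd L"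
  shows
    \<comment> \<open>correctness\<close>
    "(\<forall>d\<in>{1..N}. \<forall>a. (\<forall>i\<in>{1..N}. a i permutes {1..S ^ (N - 1)}) \<longrightarrow>
        (\<exists>dec :: (nat \<Rightarrow> sum_query \<Rightarrow> bit list) \<Rightarrow> nat \<Rightarrow> bit list.
           \<forall>W\<in>file_systems N L. \<forall>m\<in>{1..S ^ (N - 1)}.
             dec (\<lambda>j\<in>{1..S}. \<lambda>Q\<in>query_set S N d a j. sum_answer (L div S ^ (N - 1)) W Q) m =
             subfile (L div S ^ (N - 1)) W d m))
     \<and>
     \<comment> \<open>privacy\<close>
     (\<forall>j\<in>{1..S}. \<forall>d\<in>{1..N}. \<forall>d'\<in>{1..N}.
        map_pmf (\<lambda>a. query_set S N d a j) (random_permutations S N) =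
        map_pmf (\<lambda>a. query_set S N d' a j) (random_permutations S N))
     \<and>
     \<comment> \<open>rate\<close>
     (\<forall>d\<in>{1..N}. \<forall>a. (\<forall>i\<in>{1..N}. a i permutes {1..S ^ (N - 1)}) \<longrightarrow>
        (\<forall>W\<in>file_systems N L.
           real (\<Sum>j=1..S. \<Sum>Q\<in>query_set S N d a j. length (sum_answer (L div S ^ (N - 1)) W Q))
             / real L = (\<Sum>i<N. 1 / real S ^ i)))
     \<and>
     \<comment> \<open>optimality\<close>
     is_pir_scheme S N L (algorithm_scheme S N L) \<and>
     (\<forall>d\<in>{1..N}. \<forall>W\<in>file_systems N L.
        pir_rate S L (algorithm_scheme S N L) d W = ennreal (\<Sum>i<N. 1 / real S ^ i)) \<and>
     (\<forall>L'>0. \<forall>P :: ('r, 'q) pir_scheme. is_pir_scheme S N L' P \<longrightarrow>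
        (\<forall>d\<in>{1..N}. \<forall>W\<in>file_systems N L'.
           pir_rate S L' P d W \<ge> ennreal (\<Sum>i<N. 1 / real S ^ i)))"
proof (intro conjI ballI allI impI)
  let ?b = "L div S ^ (N - 1)"
  have N: "N \<ge> 1" and L: "S ^ (N - 1) * ?b = L" using assms by simp_all
  note S = assms(1) N
  show "\<exists>dec. \<forall>W\<in>file_systems N L. \<forall>m\<in>{1..S ^ (N - 1)}.
      dec (\<lambda>j\<in>{1..S}. \<lambda>Q\<in>query_set S N d a j. sum_answer ?b W Q) m = subfile ?b W d m"
    if "d \<in> {1..N}" "\<forall>i\<in>{1..N}. a i permutes {1..S ^ (N - 1)}" for d a
    using that by (intro correctness S L) auto
  show "map_pmf (\<lambda>a. query_set S N d a j) (random_permutations S N)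
      = map_pmf (\<lambda>a. query_set S N d' a j) (random_permutations S N)"
    if "j \<in> {1..S}" "d \<in> {1..N}" "d' \<in> {1..N}" for j d d'
    using that by (intro privacy S)
  show "real (\<Sum>j=1..S. \<Sum>Q\<in>query_set S N d a j. length (sum_answer ?b W Q)) / real L
      = (\<Sum>i<N. 1 / real S ^ i)"
    if "d \<in> {1..N}" "\<forall>i\<in>{1..N}. a i permutes {1..S ^ (N - 1)}" for d a W
    using total_download[where a = a, OF S that(1) _ L] that(2) assms(3)
    by (simp add: length_sum_answer del: of_nat_sum)
  show "is_pir_scheme S N L (algorithm_scheme S N L)"
    using assms(4) by (rule algorithm_is_pir_scheme[OF S])
  show "pir_rate S L (algorithm_scheme S N L) d W = ennreal (\<Sum>i<N. 1 / real S ^ i)"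
    if "d \<in> {1..N}" for d W
    using that by (intro algorithm_pir_rate S assms)
  show "ennreal (\<Sum>i<N. 1 / real S ^ i) \<le> pir_rate S L' P d W"
    if "L' > 0" "is_pir_scheme S N L' P" "d \<in> {1..N}" "W \<in> file_systems N L'"
    for L' and P :: "('r, 'q) pir_scheme" and d W
    using that assms(1) by (intro pir_rate_ge_capacity) auto
qed

end
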